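(* For all integers $d,\beta\geq 1$ there exist constants $C=C(d,\beta)$ and $g=g(d,\beta)$ such that the following holds. Let $P$ be a set of $n$ points moving polynomially in $\mathbb{R}^d$ with description complexity $\beta$ and satisfying the general position assumption below, and let $r\geq 2$. Then there exists a kinetic weak $\frac{1}{r}$-net $N$ for $P$ with $|N|\leq C\, r^{\frac{d(d+1)}{2}}\log^{d} r$ and description complexity at most $g$. Moreover, the first coordinate of each moving point of $N$ is a polynomial.
   Context: A moving point is a function $p:\mathbb{R}_+\to\mathbb{R}^d\cup\{\emptyset\}$, $p(t)=(p_1(t),\ldots,p_d(t))$, undefined at $t$ if some coordinate is undefined. It moves polynomially if each coordinate is a polynomial in $t$. A set of moving points has description complexity $\beta$ if every coordinate of every point is a rational function whose numerator and denominator have degree at most $\beta$ (for polynomial motion: polynomials of degree at most $\beta$). $P(t)=\{p(t):p\in P\}$. General position assumption: for every $t\geq 0$, the affine hull of any $d$ points of $P(t)$ is a hyperplane, and no $d+2$ points of $P(t)$ lie in a common hyperplane. A set $N$ of moving points is a kinetic weak $\frac1r$-net for $P$ if for every $t\in\mathbb{R}_+$ and every convex set $C\subset\mathbb{R}^d$ with $|C\cap P(t)|>n/r$ we have $C\cap N(t)\neq\emptyset$. *)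

theory Defs
  imports "HOL-Analysis.Analysis" "HOL-Computational_Algebra.Polynomial"
begin

text \<open>
  A moving point is the tuple of its coordinates, each a partial function of time.  Keeping
  the coordinates separate (instead of a single partial map into the space) is needed to speak
  of one coordinate being a polynomial while the point itself is undefined at times where
  another coordinate is.  Coordinates are undefined at negative times, so that moving points
  are equal iff they agree on all times \<open>t \<ge> 0\<close>.
\<close>

type_synonym 'n moving_point = "'n \<Rightarrow> (real \<rightharpoonup> real)"

definition rational_fun :: "real poly \<Rightarrow> real poly \<Rightarrow> real \<rightharpoonup> real" where
  "rational_fun a b =
     (\<lambda>t. if 0 \<le> t \<and> poly b t \<noteq> 0 then Some (poly a t / poly b t) else None)"

definition polynomial_fun :: "real poly \<Rightarrow> real \<rightharpoonup> real" where
  "polynomial_fun f = (\<lambda>t. if 0 \<le> t then Some (poly f t) else None)"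

definition is_polynomial :: "(real \<rightharpoonup> real) \<Rightarrow> bool" where
  "is_polynomial c \<longleftrightarrow> (\<exists>f. c = polynomial_fun f)"

definition moves_polynomially :: "'n moving_point \<Rightarrow> bool" where
  "moves_polynomially p \<longleftrightarrow> (\<forall>i. is_polynomial (p i))"

definition description_complexity :: "nat \<Rightarrow> 'n moving_point set \<Rightarrow> bool" where
  "description_complexity \<beta> P \<longleftrightarrow>
     (\<forall>p\<in>P. \<forall>i. \<exists>a b. b \<noteq> 0 \<and> degree a \<le> \<beta> \<and> degree b \<le> \<beta> \<and> p i = rational_fun a b)"

definition position :: "'n::finite moving_point \<Rightarrow> real \<rightharpoonup> real ^ 'n" where
  "position p t = (if \<forall>i. p i t \<noteq> None then Some (\<chi> i. the (p i t)) else None)"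

definition positions :: "'n::finite moving_point set \<Rightarrow> real \<Rightarrow> (real ^ 'n) set" where
  "positions P t = {x. \<exists>p\<in>P. position p t = Some x}"

definition hyperplane :: "(real ^ 'n::finite) set \<Rightarrow> bool" where
  "hyperplane H \<longleftrightarrow> (\<exists>a b. a \<noteq> 0 \<and> H = {x. a \<bullet> x = b})"

definition general_position :: "'n::finite moving_point set \<Rightarrow> bool" where
  "general_position P \<longleftrightarrow>
     (\<forall>t\<ge>0.
        (\<forall>A \<subseteq> positions P t. card A = CARD('n) \<longrightarrow> hyperplane (affine hull A)) \<and>
        (\<forall>A \<subseteq> positions P t. card A = CARD('n) + 2 \<longrightarrow> \<not> (\<exists>H. hyperplane H \<and> A \<subseteq> H)))"

definition kinetic_weak_net ::
    "real \<Rightarrow> 'n::finite moving_point set \<Rightarrow> 'n moving_point set \<Rightarrow> bool" where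
  "kinetic_weak_net r P N \<longleftrightarrow>
     (\<forall>t\<ge>0. \<forall>C. convex C \<and> real (card (C \<inter> positions P t)) > real (card P) / r
        \<longrightarrow> C \<inter> positions N t \<noteq> {})"

text \<open>For polynomial motion, description complexity is a bound on the degrees.\<close>

lemma description_complexity_polynomial_iff:
  assumes "\<forall>p\<in>P. moves_polynomially p"
  shows "description_complexity \<beta> P \<longleftrightarrow>
    (\<forall>p\<in>P. \<forall>i. \<exists>f. degree f \<le> \<beta> \<and> p i = polynomial_fun f)"
proof
  assume dc: "description_complexity \<beta> P"
  show "\<forall>p\<in>P. \<forall>i. \<exists>f. degree f \<le> \<beta> \<and> p i = polynomial_fun f"
  proof (intro ballI allI)
    fix p i assume p: "p \<in> P"
    then obtain f where f: "p i = polynomial_fun f"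
      using assms by (auto simp: moves_polynomially_def is_polynomial_def)
    obtain a b where ab: "b \<noteq> 0" "degree a \<le> \<beta>" "p i = rational_fun a b"
      using dc p unfolding description_complexity_def by blast
    have root: "poly (f * b - a) t = 0" if "t \<ge> 0" for t
    proof -
      have "polynomial_fun f t = rational_fun a b t" using f ab(3) by simp
      then show ?thesis
        using that by (auto simp: polynomial_fun_def rational_fun_def split: if_splits)
    qed
    have "infinite {t::real. poly (f * b - a) t = 0}"
    proof
      assume "finite {t::real. poly (f * b - a) t = 0}"
      then have "finite {0::real..}" by (rule rev_finite_subset) (use root in auto)
      then show False using infinite_Ici by blast
    qed
    then have "f * b - a = 0" using poly_roots_finite by blast
    then have "a = f * b" by simp
    then have "degree f \<le> \<beta>"
      using ab by (cases "f = 0") (auto simp: degree_mult_eq)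
    then show "\<exists>f. degree f \<le> \<beta> \<and> p i = polynomial_fun f" using f by blast
  qed
next
  assume h: "\<forall>p\<in>P. \<forall>i. \<exists>f. degree f \<le> \<beta> \<and> p i = polynomial_fun f"
  have "polynomial_fun f = rational_fun f 1" for f
    by (auto simp: polynomial_fun_def rational_fun_def)
  then show "description_complexity \<beta> P"
    using h unfolding description_complexity_def
    by (metis degree_1 one_neq_zero zero_le)
qed

end

theory Submission
  imports Defs "HOL-Real_Asymp.Real_Asymp"
begin

text \<open>
  Write \<open>d\<close> for the dimension. The coordinates of the net points are chosen one after the other.
  Suppose that \<open>k\<close> of them have been chosen as rational functions of time, and let \<open>F\<close> be the moving
  flat on which the first \<open>k\<close> coordinates have these values. The affine hull of a
  \<open>(k + 1)\<close>-tuple of points of \<open>P\<close> meets \<open>F\<close> in general in one point, whose next coordinate is again a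
  rational function of bounded degree. Among these \<open>n ^ (k + 1)\<close> functions we take an
  \<open>\<epsilon>\<close>-net for intervals, with \<open>\<epsilon>\<close> of order \<open>1 / r ^ (k + 1)\<close>; it has size \<open>O(r ^ (k + 1) ln r)\<close>,
  because the sign patterns of polynomials in one variable are few, and its elements are the
  possible next coordinates.

  The invariant for a convex set with a set \<open>Q\<close> of \<open>m > n / r\<close> points is that, for some choice made so far,
  a constant fraction of the tuples in \<open>Q ^ (k + 1)\<close> span simplices that meet \<open>F\<close>. General position makes
  degenerate tuples rare. The net hits the middle third of the next coordinates of the remaining
  tuples, so there are many pairs of simplices on both sides of the new hyperplane. The hull of
  such a pair meets the new flat, by Caratheodory's theorem already the hull of \<open>k + 2\<close> of its
  vertices does, and by double counting the invariant holds for \<open>k + 1\<close>. At \<open>k = d\<close> the flat is a point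
  in the hull of points of \<open>Q\<close>. If \<open>n / r\<close> is bounded, \<open>P\<close> itself is a small net.
\<close>

section \<open>Epsilon nets for intervals of moving numbers\<close>

text \<open>Count the pairs \<open>(y, i)\<close> with \<open>y i \<in> R\<close>: there are at
  least \<open>\<epsilon> * s * card X ^ s\<close>. Samples with fewer than \<open>h\<close> hits
  account for at most half of this number, and every other sample for at most
  \<open>s\<close>.\<close>

lemma card_PiE_hits_ge:
  fixes X R :: "'a set" and \<epsilon> :: real
  assumes X: "finite X" and R: "R \<subseteq> X" "\<epsilon> * card X \<le> card R"
    and h: "real h \<le> \<epsilon> * s / 2" and s: "s > 0"
  shows "\<epsilon> / 2 * card X ^ s \<le> card {y \<in> {..<s} \<rightarrow>\<^sub>E X. h \<le> card {i\<in>{..<s}. y i \<in> R}}"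
proof -
  define A where "A = {..<s} \<rightarrow>\<^sub>E X"
  define G where "G = {y \<in> A. h \<le> card {i\<in>{..<s}. y i \<in> R}}"
  have fA: "finite A" and cA: "card A = card X ^ s"
    using X by (auto simp: A_def intro!: finite_PiE simp: card_PiE)
  have hit: "card {y\<in>A. y i \<in> R} = card R * card X ^ (s - 1)" if "i < s" for i
  proof -
    have "{y\<in>A. y i \<in> R} = PiE {..<s} (\<lambda>j. if j = i then R else X)"
    proof (rule set_eqI)
      fix y
      have "(\<forall>j\<in>{..<s}. y j \<in> X) \<and> y i \<in> R \<longleftrightarrow> (\<forall>j\<in>{..<s}. y j \<in> (if j = i then R else X))"
        using that R(1) by (auto split: if_splits)
      then show "y \<in> {y\<in>A. y i \<in> R} \<longleftrightarrow> y \<in> PiE {..<s} (\<lambda>j. if j = i then R else X)"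
        unfolding A_def PiE_iff mem_Collect_eq by blast
    qed
    then have "card {y\<in>A. y i \<in> R} = (\<Prod>j<s. if j = i then card R else card X)"
      by (simp add: card_PiE if_distrib)
    also have "\<dots> = card R * (\<Prod>j\<in>{..<s}-{i}. card X)"
      using that by (subst prod.remove[of _ i]) (auto intro!: prod.cong)
    finally show ?thesis using that by simp
  qed
  have "(\<Sum>y\<in>A. card {i\<in>{..<s}. y i \<in> R}) = (\<Sum>y\<in>A. \<Sum>i<s. if y i \<in> R then 1 else 0)"
    by (intro sum.cong refl) (simp add: sum.If_cases Int_def)
  also have "\<dots> = (\<Sum>i<s. \<Sum>y\<in>A. if y i \<in> R then 1 else 0)"
    by (rule sum.swap)
  also have "\<dots> = (\<Sum>i<s. card {y\<in>A. y i \<in> R})"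
    using fA by (intro sum.cong refl) (simp add: sum.If_cases Int_def)
  also have "\<dots> = s * (card R * card X ^ (s - 1))"
    using hit by simp
  finally have tot: "(\<Sum>y\<in>A. card {i\<in>{..<s}. y i \<in> R}) = s * (card R * card X ^ (s - 1))" .
  have "(\<Sum>y\<in>A. card {i\<in>{..<s}. y i \<in> R}) \<le> (\<Sum>y\<in>A. (if y \<in> G then s else 0) + h)"
  proof (rule sum_mono)
    fix y assume "y \<in> A"
    have "card {i\<in>{..<s}. y i \<in> R} \<le> card {..<s}" by (rule card_mono) auto
    with \<open>y \<in> A\<close> show "card {i\<in>{..<s}. y i \<in> R} \<le> (if y \<in> G then s else 0) + h"
      by (auto simp: G_def)
  qed
  also have "\<dots> = s * card G + h * card A"
    using fA by (simp add: sum.distrib sum.If_cases Int_def G_def)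
  finally have "s * (card R * card X ^ (s - 1)) \<le> s * card G + h * card A"
    using tot by simp
  then have "real (s * (card R * card X ^ (s - 1))) \<le> real (s * card G + h * card A)"
    using of_nat_le_iff by blast
  then have 1: "real s * (card R * real (card X) ^ (s - 1)) \<le> real s * card G + h * real (card X) ^ s"
    by (simp add: cA)
  have "\<epsilon> * card X * real (card X) ^ (s - 1) \<le> card R * real (card X) ^ (s - 1)"
    by (rule mult_right_mono[OF R(2)]) simp
  moreover have "real (card X) * real (card X) ^ (s - 1) = real (card X) ^ s"
    using s by (metis power_eq_if neq0_conv)
  ultimately have "\<epsilon> * real (card X) ^ s \<le> card R * real (card X) ^ (s - 1)"
    by (simp add: mult.assoc)
  then have "real s * (\<epsilon> * real (card X) ^ s) \<le> real s * (card R * real (card X) ^ (s - 1))"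
    by (rule mult_left_mono) simp
  moreover have "h * real (card X) ^ s \<le> \<epsilon> * s / 2 * real (card X) ^ s"
    by (rule mult_right_mono[OF h]) simp
  ultimately have "real s * (\<epsilon> * real (card X) ^ s) \<le> real s * card G + \<epsilon> * s / 2 * real (card X) ^ s"
    using 1 by linarith
  then have "real s * (\<epsilon> / 2 * real (card X) ^ s) \<le> real s * card G"
    by (simp add: algebra_simps)
  then have "\<epsilon> / 2 * real (card X) ^ s \<le> card G"
    using s by (simp only: mult_le_cancel_left_pos of_nat_0_less_iff)
  then show ?thesis by (simp add: G_def A_def)
qed

text \<open>An index \<open>i\<close> with \<open>x i\<close> or \<open>y i\<close> in
  \<open>T\<close> is forced: keeping the first sample out of \<open>T\<close> puts \<open>i\<close>
  into \<open>b\<close> exactly when \<open>y i \<notin> T\<close>. Once some \<open>b\<close>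
  qualifies there are at least \<open>h\<close> such indices, so \<open>b\<close> is free on at most
  \<open>s - h\<close> others.\<close>

lemma card_separating_swaps_le:
  fixes x y :: "nat \<Rightarrow> 'a"
  shows "card {b \<in> Pow {..<s}. (\<forall>i<s. (if i \<in> b then y i else x i) \<notin> T) \<and>
      h \<le> card {i\<in>{..<s}. (if i \<in> b then x i else y i) \<in> T}} \<le> 2 ^ (s - h)"
    (is "card ?B \<le> _")
proof (cases "?B = {}")
  case True
  then show ?thesis by (simp only: card.empty)
next
  case False
  then obtain b0 where b0: "b0 \<in> ?B" by blast
  define H where "H = {i\<in>{..<s}. x i \<in> T \<or> y i \<in> T}"
  have "{i\<in>{..<s}. (if i \<in> b0 then x i else y i) \<in> T} \<subseteq> H"
    by (auto simp: H_def)
  then have "card {i\<in>{..<s}. (if i \<in> b0 then x i else y i) \<in> T} \<le> card H"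
    by (intro card_mono) (auto simp: H_def)
  with b0 have hH: "h \<le> card H" by auto
  have det: "i \<in> b \<longleftrightarrow> y i \<notin> T" if "b \<in> ?B" "i \<in> H" for b i
    using that by (auto simp: H_def split: if_splits)
  have "inj_on (\<lambda>b. b - H) ?B"
  proof (rule inj_onI)
    fix b b' assume bb: "b \<in> ?B" "b' \<in> ?B" "b - H = b' - H"
    have "i \<in> b \<longleftrightarrow> i \<in> b'" for i
      using det[OF bb(1), of i] det[OF bb(2), of i] bb(3) by blast
    then show "b = b'" by blast
  qed
  moreover have "(\<lambda>b. b - H) ` ?B \<subseteq> Pow ({..<s} - H)" by auto
  ultimately have "card ?B \<le> card (Pow ({..<s} - H))"
    by (intro card_inj_on_le) auto
  also have "\<dots> = 2 ^ (s - card H)"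
    by (subst card_Pow, simp, subst card_Diff_subset) (auto simp: H_def)
  also have "\<dots> \<le> 2 ^ (s - h)" using hH by (intro power_increasing) auto
  finally show ?thesis .
qed

text \<open>
  Double sampling: compare the pairs of samples \<open>(x, y)\<close> with \<open>x\<close> missing and \<open>y\<close> hitting a range often
  with those obtained by swapping \<open>x i\<close> and \<open>y i\<close> for the indices \<open>i\<close> in a set \<open>b\<close>. The averaging bound
  above replaces Chebyshev's inequality; it loses a factor \<open>\<epsilon>\<close>, which the logarithm absorbs.
\<close>

lemma hitting_set_of_trace_bound:
  fixes X :: "'a set" and F :: "'a set set" and \<epsilon> :: real
  assumes X: "finite X" "X \<noteq> {}" and s: "s > 0"
    and big: "\<And>R. R \<in> F \<Longrightarrow> R \<subseteq> X \<and> \<epsilon> * card X \<le> card R"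
    and trace: "\<And>Y. Y \<subseteq> X \<Longrightarrow> card Y \<le> 2 * s \<Longrightarrow> card ((\<lambda>R. R \<inter> Y) ` F) \<le> \<Phi>"
    and h: "real h \<le> \<epsilon> * s / 2" and \<Phi>: "2 * real \<Phi> < \<epsilon> * 2 ^ h"
    and \<epsilon>: "\<epsilon> \<le> 1"
  shows "\<exists>S\<subseteq>X. card S \<le> s \<and> (\<forall>R\<in>F. S \<inter> R \<noteq> {})"
proof (rule ccontr)
  assume no: "\<not> ?thesis"
  define A where "A = {..<s} \<rightarrow>\<^sub>E X"
  define hits where "hits = (\<lambda>(y :: nat \<Rightarrow> 'a) R. h \<le> card {i\<in>{..<s}. y i \<in> R})"
  define bad where "bad = (\<lambda>(x, y). \<exists>R\<in>F. (\<forall>i<s. x i \<notin> R) \<and> hits y R)"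
  define sw where "sw = (\<lambda>b (x :: nat \<Rightarrow> 'a, y :: nat \<Rightarrow> 'a).
    (\<lambda>i\<in>{..<s}. if i \<in> b then y i else x i, \<lambda>i\<in>{..<s}. if i \<in> b then x i else y i))"
  have fA: "finite A" and cA: "card A = card X ^ s"
    using X by (auto simp: A_def intro!: finite_PiE simp: card_PiE)
  have F: "finite F" using big X(1) by (intro finite_subset[of F "Pow X"]) auto
  have hs: "h \<le> s"
  proof -
    have "\<epsilon> * s \<le> 1 * real s" using \<epsilon> by (rule mult_right_mono) simp
    with h show ?thesis by linarith
  qed
  have miss: "\<exists>R\<in>F. \<forall>i<s. x i \<notin> R" if "x \<in> A" for x
  proof -
    have "x ` {..<s} \<subseteq> X" "card (x ` {..<s}) \<le> s"
      using that card_image_le[of "{..<s}" x] by (auto simp: A_def)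
    then obtain R where "R \<in> F" "x ` {..<s} \<inter> R = {}" using no by blast
    then show ?thesis by blast
  qed
  \<comment> \<open>For fixed \<open>x\<close> a single range missed by \<open>x\<close> suffices:
    at least an \<open>\<epsilon> / 2\<close> fraction of the samples \<open>y\<close> hits it at
    least \<open>h\<close> times.\<close>
  have lower: "\<epsilon> / 2 * real (card X) ^ s \<le> card {y\<in>A. bad (x, y)}" if xA: "x \<in> A" for x
  proof -
    obtain R where R: "R \<in> F" "\<forall>i<s. x i \<notin> R" using miss[OF xA] by blast
    have "\<epsilon> / 2 * real (card X) ^ s \<le> card {y\<in>A. hits y R}"
      using card_PiE_hits_ge[OF X(1) _ _ h s, of R] big[OF R(1)] by (simp add: A_def hits_def)
    also have "\<dots> \<le> card {y\<in>A. bad (x, y)}"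
      using R fA by (auto simp: bad_def intro!: card_mono)
    finally show ?thesis .
  qed
  have Bad: "{z\<in>A\<times>A. bad z} = (SIGMA x:A. {y\<in>A. bad (x, y)})" by auto
  have "real (card {z\<in>A\<times>A. bad z}) = (\<Sum>x\<in>A. real (card {y\<in>A. bad (x, y)}))"
    unfolding Bad using fA by (subst card_SigmaI) auto
  also have "\<dots> \<ge> (\<Sum>x\<in>A. \<epsilon> / 2 * real (card X) ^ s)"
    using lower by (rule sum_mono)
  finally have lo: "\<epsilon> / 2 * real (card X) ^ s * card A \<le> card {z\<in>A\<times>A. bad z}"
    by (simp add: mult.commute)
  have swA: "sw b z \<in> A \<times> A" if "z \<in> A \<times> A" for b z
    using that by (auto simp: sw_def A_def PiE_iff split: prod.splits)
  have swsw: "sw b (sw b z) = z" if "z \<in> A \<times> A" for b z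
    using that by (auto simp: sw_def A_def PiE_iff extensional_def fun_eq_iff split: prod.splits)
  \<comment> \<open>Each swap is an involution of \<open>A \<times> A\<close>, hence a bijection
    between these two sets of pairs.\<close>
  have swcard: "card {z\<in>A\<times>A. bad (sw b z)} = card {z\<in>A\<times>A. bad z}" for b
  proof (rule bij_betw_same_card)
    show "bij_betw (sw b) {z\<in>A\<times>A. bad (sw b z)} {z\<in>A\<times>A. bad z}"
    proof (rule bij_betw_byWitness[where f' = "sw b"])
      show "sw b ` {z \<in> A \<times> A. bad (sw b z)} \<subseteq> {z \<in> A \<times> A. bad z}" using swA by blast
      show "sw b ` {z \<in> A \<times> A. bad z} \<subseteq> {z \<in> A \<times> A. bad (sw b z)}"
      proof
        fix z' assume "z' \<in> sw b ` {z \<in> A \<times> A. bad z}"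
        then obtain z where "z \<in> A \<times> A" "bad z" "z' = sw b z" by blast
        then show "z' \<in> {z \<in> A \<times> A. bad (sw b z)}" using swA[of z b] swsw[of z b] by simp
      qed
    qed (use swsw in auto)
  qed
  \<comment> \<open>For a fixed pair \<open>z\<close> a range matters only through its trace on the
    at most \<open>2 * s\<close> sampled elements. Each of the at most \<open>\<Phi>\<close> traces
    allows at most \<open>2 ^ (s - h)\<close> swaps.\<close>
  have upper: "card {b\<in>Pow {..<s}. bad (sw b z)} \<le> \<Phi> * 2 ^ (s - h)" if z: "z \<in> A \<times> A" for z
  proof -
    obtain x y where xy: "z = (x, y)" "x \<in> A" "y \<in> A" using z by blast
    define Y where "Y = x ` {..<s} \<union> y ` {..<s}"
    define TT where "TT = (\<lambda>R. R \<inter> Y) ` F"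
    define V where "V = (\<lambda>T. {b \<in> Pow {..<s}. (\<forall>i<s. (if i \<in> b then y i else x i) \<notin> T) \<and>
      h \<le> card {i\<in>{..<s}. (if i \<in> b then x i else y i) \<in> T}})"
    have "Y \<subseteq> X" using xy by (auto simp: Y_def A_def)
    moreover have "card Y \<le> 2 * s"
      unfolding Y_def using card_Un_le[of "x ` {..<s}" "y ` {..<s}"]
        card_image_le[of "{..<s}" x] card_image_le[of "{..<s}" y] by simp
    ultimately have cT: "card TT \<le> \<Phi>" unfolding TT_def by (rule trace)
    have "{b\<in>Pow {..<s}. bad (sw b z)} \<subseteq> (\<Union>T\<in>TT. V T)"
    proof
      fix b assume b: "b \<in> {b\<in>Pow {..<s}. bad (sw b z)}"
      then obtain R where R: "R \<in> F" "\<forall>i<s. (if i \<in> b then y i else x i) \<notin> R"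
        "h \<le> card {i\<in>{..<s}. restrict (\<lambda>i. if i \<in> b then x i else y i) {..<s} i \<in> R}"
        by (auto simp: bad_def sw_def xy hits_def)
      have "{i\<in>{..<s}. restrict (\<lambda>i. if i \<in> b then x i else y i) {..<s} i \<in> R} =
          {i\<in>{..<s}. (if i \<in> b then x i else y i) \<in> R \<inter> Y}"
        by (auto simp: Y_def)
      with R b have "b \<in> V (R \<inter> Y)" by (auto simp: V_def)
      with R(1) show "b \<in> (\<Union>T\<in>TT. V T)" by (auto simp: TT_def)
    qed
    then have "card {b\<in>Pow {..<s}. bad (sw b z)} \<le> card (\<Union>T\<in>TT. V T)"
      by (rule card_mono[rotated]) (auto simp: TT_def V_def F)
    also have "\<dots> \<le> (\<Sum>T\<in>TT. card (V T))"
      by (rule card_UN_le) (simp add: TT_def F)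
    also have "\<dots> \<le> (\<Sum>T\<in>TT. 2 ^ (s - h))"
      unfolding V_def by (intro sum_mono card_separating_swaps_le)
    also have "\<dots> \<le> \<Phi> * 2 ^ (s - h)" using cT by simp
    finally show ?thesis .
  qed
  \<comment> \<open>Double counting of the pairs \<open>(b, z)\<close> for which
    \<open>sw b z\<close> is bad.\<close>
  have "2 ^ s * card {z\<in>A\<times>A. bad z} = (\<Sum>b\<in>Pow {..<s}. card {z\<in>A\<times>A. bad (sw b z)})"
    by (simp add: swcard card_Pow)
  also have "\<dots> = (\<Sum>b\<in>Pow {..<s}. \<Sum>z\<in>A\<times>A. if bad (sw b z) then 1 else 0)"
    using fA by (intro sum.cong refl) (simp add: sum.If_cases Int_def)
  also have "\<dots> = (\<Sum>z\<in>A\<times>A. \<Sum>b\<in>Pow {..<s}. if bad (sw b z) then 1 else 0)"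
    by (rule sum.swap)
  also have "\<dots> = (\<Sum>z\<in>A\<times>A. card {b\<in>Pow {..<s}. bad (sw b z)})"
    by (intro sum.cong refl) (simp add: sum.If_cases Int_def)
  also have "\<dots> \<le> (\<Sum>z\<in>A\<times>A. \<Phi> * 2 ^ (s - h))"
    using upper by (rule sum_mono)
  also have "\<dots> = card A * card A * \<Phi> * 2 ^ (s - h)" by (simp add: card_cartesian_product)
  finally have "real (2 ^ s * card {z\<in>A\<times>A. bad z}) \<le> real (card A * card A * \<Phi> * 2 ^ (s - h))"
    using of_nat_le_iff by blast
  then have up: "2 ^ s * real (card {z\<in>A\<times>A. bad z}) \<le> (real (card A) * card A) * (\<Phi> * 2 ^ (s - h))"
    by (simp add: algebra_simps)
  have "2 ^ s * (\<epsilon> / 2 * real (card X) ^ s * card A) \<le> 2 ^ s * real (card {z\<in>A\<times>A. bad z})"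
    using lo by (rule mult_left_mono) simp
  also note up
  finally have "(real (card A) * card A) * (2 ^ s * \<epsilon> / 2) \<le> (real (card A) * card A) * (\<Phi> * 2 ^ (s - h))"
    by (simp add: cA algebra_simps)
  moreover have "real (card A) * card A > 0" using X by (simp add: cA card_gt_0_iff)
  ultimately have "2 ^ s * \<epsilon> / 2 \<le> \<Phi> * 2 ^ (s - h)"
    using mult_le_cancel_left_pos by blast
  moreover have "(2::real) ^ s = 2 ^ (s - h) * 2 ^ h" using hs by (simp flip: power_add)
  ultimately have "2 ^ (s - h) * (\<epsilon> * 2 ^ h) \<le> 2 ^ (s - h) * (2 * real \<Phi>)" by (simp add: mult.commute)
  then have "\<epsilon> * 2 ^ h \<le> 2 * real \<Phi>" by simp
  with \<Phi> show False by simp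
qed

section \<open>Sign patterns of finitely many polynomials in one variable\<close>

text \<open>By the intermediate value theorem a change of sign needs a root separating
  \<open>t\<close> from \<open>t'\<close>. The guard \<open>p \<noteq> 0\<close> exempts the zero
  polynomial, whose sign is constant although every number is a root.\<close>

lemma sgn_poly_eq_of_no_root_between:
  fixes p :: "real poly"
  assumes "\<And>z. poly p z = 0 \<Longrightarrow> p \<noteq> 0 \<Longrightarrow> (z < t \<longleftrightarrow> z < t') \<and> (z = t \<longleftrightarrow> z = t')"
  shows "sgn (poly p t) = sgn (poly p t')"
proof (cases "p = 0")
  case False
  have *: "sgn (poly p u) = sgn (poly p v)"
    if "u < v" "\<And>z. poly p z = 0 \<Longrightarrow> (z < u \<longleftrightarrow> z < v) \<and> (z = u \<longleftrightarrow> z = v)" for u v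
  proof -
    have nz: "poly p u \<noteq> 0" "poly p v \<noteq> 0" using that by (metis less_irrefl)+
    have no: "poly p z \<noteq> 0" if "u < z" "z < v" for z
      using \<open>\<And>z. poly p z = 0 \<Longrightarrow> (z < u \<longleftrightarrow> z < v) \<and> (z = u \<longleftrightarrow> z = v)\<close>[of z] that by auto
    have "\<not> (poly p u < 0 \<and> 0 < poly p v)" using poly_IVT_pos[OF that(1), of p] no by blast
    moreover have "\<not> (poly p v < 0 \<and> 0 < poly p u)" using poly_IVT_neg[OF that(1), of p] no by blast
    ultimately show ?thesis using nz by (auto simp: sgn_real_def)
  qed
  show ?thesis
  proof (cases t t' rule: linorder_cases)
    case less
    then show ?thesis using assms False by (intro *) auto
  next
    case greater
    then have "sgn (poly p t') = sgn (poly p t)" using assms False by (intro *) auto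
    then show ?thesis by simp
  qed simp
qed simp

text \<open>The pattern is constant on each piece into which the roots of the nonzero polynomials
  cut the line, and there are at most \<open>card I * D\<close> roots.\<close>

lemma card_poly_sign_patterns_le:
  fixes q :: "'i \<Rightarrow> real poly"
  assumes I: "finite I" and deg: "\<And>i. i \<in> I \<Longrightarrow> degree (q i) \<le> D"
  shows "finite (range (\<lambda>t. \<lambda>i\<in>I. sgn (poly (q i) t)))"
    and "card (range (\<lambda>t. \<lambda>i\<in>I. sgn (poly (q i) t))) \<le> 2 * (card I * D + 1)"
proof -
  define Z where "Z = (\<Union>i\<in>{i\<in>I. q i \<noteq> 0}. {z. poly (q i) z = 0})"
  have Z: "finite Z" using I by (auto simp: Z_def poly_roots_finite)
  have "card Z \<le> (\<Sum>i\<in>{i\<in>I. q i \<noteq> 0}. card {z. poly (q i) z = 0})"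
    unfolding Z_def using I by (intro card_UN_le) auto
  also have "\<dots> \<le> (\<Sum>i\<in>{i\<in>I. q i \<noteq> 0}. D)"
    using deg by (intro sum_mono) (auto intro: order_trans[OF card_poly_roots_bound])
  also have "\<dots> \<le> card I * D"
    using I by (simp add: card_mono)
  finally have cZ: "card Z \<le> card I * D" .
  define w where "w = (\<lambda>t. \<lambda>i\<in>I. sgn (poly (q i) t))"
  \<comment> \<open>A piece is coded by the number of roots to the left of \<open>t\<close> and by
    whether \<open>t\<close> is itself a root; the latter gives the factor 2.\<close>
  define \<kappa> where "\<kappa> = (\<lambda>t. (card {z\<in>Z. z < t}, t \<in> Z))"
  have det: "w t = w t'" if eq: "\<kappa> t = \<kappa> t'" for t t'
  proof -
    have sub: "{z\<in>Z. z < t} = {z\<in>Z. z < t'}"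
    proof (cases "t \<le> t'")
      case True
      then have "{z\<in>Z. z < t} \<subseteq> {z\<in>Z. z < t'}" by auto
      then show ?thesis using eq Z by (intro card_subset_eq) (auto simp: \<kappa>_def)
    next
      case False
      then have "{z\<in>Z. z < t'} \<subseteq> {z\<in>Z. z < t}" by auto
      then have "{z\<in>Z. z < t'} = {z\<in>Z. z < t}" using eq Z by (intro card_subset_eq) (auto simp: \<kappa>_def)
      then show ?thesis by simp
    qed
    have in_iff: "t \<in> Z \<longleftrightarrow> t' \<in> Z" using eq by (simp add: \<kappa>_def)
    have key: "(z < t \<longleftrightarrow> z < t') \<and> (z = t \<longleftrightarrow> z = t')" if "z \<in> Z" for z
      using sub in_iff that by (smt (verit) mem_Collect_eq)
    show ?thesis unfolding w_def
      by (intro restrict_ext sgn_poly_eq_of_no_root_between key) (auto simp: Z_def)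
  qed
  have sub: "range \<kappa> \<subseteq> {..card I * D} \<times> UNIV"
    using cZ Z by (auto simp: \<kappa>_def intro!: order_trans[OF card_mono cZ])
  have fk: "finite (range \<kappa>)" using sub by (rule finite_subset) simp
  have ck: "card (range \<kappa>) \<le> 2 * (card I * D + 1)"
    using card_mono[OF _ sub] by (simp add: card_cartesian_product)
  have "w t = w (SOME t'. \<kappa> t' = \<kappa> t)" for t
    by (rule det) (metis (mono_tags, lifting) someI)
  then have rw: "range w \<subseteq> (\<lambda>c. w (SOME t'. \<kappa> t' = c)) ` range \<kappa>" by auto
  show "finite (range (\<lambda>t. \<lambda>i\<in>I. sgn (poly (q i) t)))"
    using finite_subset[OF rw] fk by (simp add: w_def)
  have "card (range w) \<le> card (range \<kappa>)"
    using card_mono[OF _ rw] card_image_le[OF fk] fk by (meson finite_imageI order_trans)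
  with ck show "card (range (\<lambda>t. \<lambda>i\<in>I. sgn (poly (q i) t))) \<le> 2 * (card I * D + 1)"
    by (simp add: w_def)
qed

section \<open>Traces of intervals of rational functions\<close>

text \<open>A number that is undefined at time \<open>t\<close> lies in no interval; without the
  condition on the denominator, division by zero would give it the value 0.\<close>

definition kinetic_interval :: "'a set \<Rightarrow> ('a \<Rightarrow> real poly) \<Rightarrow> ('a \<Rightarrow> real poly) \<Rightarrow> real \<Rightarrow> real \<Rightarrow> real \<Rightarrow> 'a set"
  where "kinetic_interval X a b t u v =
    {x\<in>X. poly (b x) t \<noteq> 0 \<and> u \<le> poly (a x) t / poly (b x) t \<and> poly (a x) t / poly (b x) t \<le> v}"

text \<open>A nonempty trace is cut out by its least and greatest values. This replaces the real
  endpoints by elements of \<open>Y\<close>, so that only finitely many functions have to be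
  compared.\<close>

lemma kinetic_interval_eq_between:
  assumes "finite Y" "kinetic_interval Y a b t u v \<noteq> {}"
  obtains x y where "x \<in> Y" "y \<in> Y" "poly (b x) t \<noteq> 0" "poly (b y) t \<noteq> 0"
    "kinetic_interval Y a b t u v = kinetic_interval Y a b t (poly (a x) t / poly (b x) t) (poly (a y) t / poly (b y) t)"
proof -
  let ?K = "kinetic_interval Y a b t u v" and ?f = "\<lambda>x. poly (a x) t / poly (b x) t"
  have fin: "finite ?K" using assms(1) by (simp add: kinetic_interval_def)
  obtain x where x: "x \<in> ?K" "\<And>z. z \<in> ?K \<Longrightarrow> ?f x \<le> ?f z"
    using ex_min_if_finite[of "?f ` ?K"] fin assms(2) by (metis (no_types, lifting) arg_min_least arg_min_if_finite(1))
  obtain y where y: "y \<in> ?K" "\<And>z. z \<in> ?K \<Longrightarrow> ?f z \<le> ?f y"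
  proof -
    obtain y where "y \<in> ?K" "\<And>z. z \<in> ?K \<Longrightarrow> - ?f y \<le> - ?f z"
      using arg_min_if_finite(1)[OF fin assms(2), of "\<lambda>z. - ?f z"]
        arg_min_least[OF fin assms(2), of _ "\<lambda>z. - ?f z"] by blast
    then show ?thesis using that by (metis neg_le_iff_le)
  qed
  show ?thesis
  proof (rule that[of x y])
    show "?K = kinetic_interval Y a b t (?f x) (?f y)"
    proof
      show "?K \<subseteq> kinetic_interval Y a b t (?f x) (?f y)"
      proof
        fix z assume z: "z \<in> ?K"
        then show "z \<in> kinetic_interval Y a b t (?f x) (?f y)"
          using x(2)[OF z] y(2)[OF z] by (simp add: kinetic_interval_def)
      qed
      show "kinetic_interval Y a b t (?f x) (?f y) \<subseteq> ?K"
        using x(1) y(1) by (fastforce simp: kinetic_interval_def)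
    qed
  qed (use x(1) y(1) in \<open>auto simp: kinetic_interval_def\<close>)
qed

text \<open>Multiplying the difference by the positive number \<open>(q * s)\<^sup>2\<close> turns
  the comparison into the sign of a polynomial expression, whatever the signs of the
  denominators.\<close>

lemma rational_le_iff_sgn:
  fixes p q r s :: real
  assumes "q \<noteq> 0" "s \<noteq> 0"
  shows "p / q \<le> r / s \<longleftrightarrow> sgn ((r * q - p * s) * (q * s)) \<noteq> -1"
proof -
  have "r / s - p / q = (r * q - p * s) * (q * s) / (q * s)\<^sup>2"
    using assms by (simp add: field_simps power2_eq_square)
  moreover have "(q * s)\<^sup>2 > 0" using assms by simp
  ultimately have "0 \<le> r / s - p / q \<longleftrightarrow> 0 \<le> (r * q - p * s) * (q * s)"
    by (metis divide_nonneg_pos divide_neg_pos not_le)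
  then show ?thesis by (auto simp: sgn_real_def)
qed

text \<open>A nonempty trace is determined by its two end elements and the signs at time
  \<open>t\<close> of \<open>2 * M\<^sup>2\<close> polynomials of degree at most
  \<open>4 * D\<close>. Hence there are at most \<open>1 + card W * M\<^sup>2\<close>
  traces.\<close>

lemma card_kinetic_interval_traces_le:
  assumes Y: "finite Y" "Y \<noteq> {}" and deg: "\<forall>x\<in>Y. degree (a x) \<le> D \<and> degree (b x) \<le> D"
  shows "finite {kinetic_interval Y a b t u v | t u v. True}"
    and "card {kinetic_interval Y a b t u v | t u v. True} \<le> (16 * D + 5) * card Y ^ 4"
proof -
  define M where "M = card Y"
  have M1: "M \<ge> 1" using Y by (simp add: M_def Suc_le_eq card_gt_0_iff)
  \<comment> \<open>The flag in \<open>(x, y, c)\<close> selects the polynomial that compares the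
    numbers of \<open>x\<close> and \<open>y\<close>, or, when false, the denominator of
    \<open>x\<close>.\<close>
  define I where "I = Y \<times> Y \<times> (UNIV :: bool set)"
  define q where "q = (\<lambda>(x, y, c). if c then (a y * b x - a x * b y) * (b x * b y) else b x)"
  define W where "W = range (\<lambda>t. \<lambda>i\<in>I. sgn (poly (q i) t))"
  have I: "finite I" and cI: "card I = 2 * M\<^sup>2"
    using Y by (auto simp: I_def card_cartesian_product M_def power2_eq_square)
  have degq: "degree (q i) \<le> 4 * D" if iI: "i \<in> I" for i
  proof -
    obtain x y c where i: "i = (x, y, c)" "x \<in> Y" "y \<in> Y" using iI by (auto simp: I_def)
    have m: "degree (p * p') \<le> e + e'" if "degree p \<le> e" "degree p' \<le> e'" for p p' :: "real poly" and e e'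
      using that degree_mult_le[of p p'] by linarith
    have "degree ((a y * b x - a x * b y) * (b x * b y)) \<le> (D + D) + (D + D)"
      using deg i by (intro m degree_diff_le) auto
    moreover have "degree (b x) \<le> D" using deg i by simp
    ultimately show ?thesis by (auto simp: q_def i(1))
  qed
  have fW: "finite W" and cW: "card W \<le> 2 * (2 * M\<^sup>2 * (4 * D) + 1)"
    using card_poly_sign_patterns_le[OF I degq] by (simp_all add: W_def cI)
  define Tr where "Tr = (\<lambda>(w, x, y). {z\<in>Y. w (z, z, False) \<noteq> (0::real) \<and> w (x, z, True) \<noteq> -1 \<and> w (z, y, True) \<noteq> -1})"
  have sub: "{kinetic_interval Y a b t u v | t u v. True} \<subseteq> insert {} (Tr ` (W \<times> Y \<times> Y))"
  proof
    fix K assume "K \<in> {kinetic_interval Y a b t u v | t u v. True}"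
    then obtain t u v where K: "K = kinetic_interval Y a b t u v" by blast
    show "K \<in> insert {} (Tr ` (W \<times> Y \<times> Y))"
    proof (cases "K = {}")
      case False
      then obtain x y where xy: "x \<in> Y" "y \<in> Y" "poly (b x) t \<noteq> 0" "poly (b y) t \<noteq> 0"
        "K = kinetic_interval Y a b t (poly (a x) t / poly (b x) t) (poly (a y) t / poly (b y) t)"
        using kinetic_interval_eq_between[OF Y(1)] K by metis
      define w where "w = (\<lambda>i\<in>I. sgn (poly (q i) t))"
      have "K = Tr (w, x, y)"
        unfolding xy(5) kinetic_interval_def Tr_def split_conv
      proof (intro Collect_cong conj_cong refl)
        fix z assume z: "z \<in> Y"
        show "poly (b z) t \<noteq> 0 \<longleftrightarrow> w (z, z, False) \<noteq> 0"
          using z by (simp add: w_def I_def q_def sgn_zero_iff)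
        assume nz: "w (z, z, False) \<noteq> 0"
        then have nz: "poly (b z) t \<noteq> 0" using z by (auto simp: w_def I_def q_def)
        show "poly (a x) t / poly (b x) t \<le> poly (a z) t / poly (b z) t \<longleftrightarrow> w (x, z, True) \<noteq> -1"
          using rational_le_iff_sgn[OF xy(3) nz] z xy by (simp add: w_def I_def q_def)
        show "poly (a z) t / poly (b z) t \<le> poly (a y) t / poly (b y) t \<longleftrightarrow> w (z, y, True) \<noteq> -1"
          using rational_le_iff_sgn[OF nz xy(4)] z xy by (simp add: w_def I_def q_def)
      qed
      moreover have "w \<in> W" by (auto simp: W_def w_def)
      ultimately show ?thesis using xy by blast
    qed simp
  qed
  have fin: "finite (insert {} (Tr ` (W \<times> Y \<times> Y)))" using fW Y by simp
  show "finite {kinetic_interval Y a b t u v | t u v. True}" using sub fin by (rule finite_subset)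
  have "card {kinetic_interval Y a b t u v | t u v. True} \<le> card (insert {} (Tr ` (W \<times> Y \<times> Y)))"
    by (rule card_mono[OF fin sub])
  also have "\<dots> \<le> Suc (card (W \<times> Y \<times> Y))"
    using card_insert_le_m1 card_image_le[of "W \<times> Y \<times> Y" Tr] fW Y
    by (metis (no_types, lifting) Suc_le_mono card_insert_if finite_SigmaI finite_imageI le_SucI)
  also have "\<dots> = Suc (card W * M\<^sup>2)" by (simp add: card_cartesian_product M_def power2_eq_square)
  also have "\<dots> \<le> 1 + (2 * (2 * M\<^sup>2 * (4 * D) + 1)) * M\<^sup>2" using mult_le_mono1[OF cW, of "M\<^sup>2"] by linarith
  also have "\<dots> = 16 * D * M ^ 4 + 2 * M\<^sup>2 + 1" by (simp add: algebra_simps power2_eq_square power4_eq_xxxx)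
  also have "\<dots> \<le> 16 * D * M ^ 4 + 2 * M ^ 4 + M ^ 4"
    using power_increasing[OF _ M1, of 2 4] one_le_power[OF M1, of 4] by linarith
  also have "\<dots> \<le> (16 * D + 5) * M ^ 4" by (simp add: algebra_simps)
  finally show "card {kinetic_interval Y a b t u v | t u v. True} \<le> (16 * D + 5) * card Y ^ 4"
    by (simp add: M_def)
qed

text \<open>With \<open>s\<close> of order \<open>K * q * ln q\<close> the threshold
  \<open>h\<close> is about \<open>K * ln q / 2\<close>. So \<open>2 ^ h\<close> is about a power of
  \<open>q\<close> whose exponent grows with \<open>K\<close>, while \<open>s ^ 4\<close> is at most
  a constant times \<open>K ^ 4 * q ^ 8\<close>.\<close>

lemma sample_size_exists:
  fixes c :: real
  assumes c: "c > 0"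
  shows "\<exists>K>0. \<forall>q\<ge>2. \<exists>s h :: nat. s > 0 \<and> real s \<le> K * q * ln q \<and> real h \<le> s / q / 2 \<and>
    2 * (c * real s ^ 4) < 2 ^ h / q"
proof -
  \<comment> \<open>The 9 pays for \<open>q ^ 8\<close> and for the division by \<open>q\<close>.
    The remaining exponent is made nonnegative, so that the inequality at base 2 carries over to
    every base \<open>q \<ge> 2\<close>.\<close>
  have "eventually (\<lambda>K::real. 64 * c * K ^ 4 < 2 powr (K * ln 2 / 2 - 9)) at_top"
    using c by real_asymp
  moreover have "eventually (\<lambda>K::real. K * ln 2 / 2 \<ge> 9) at_top" by real_asymp
  moreover have "eventually (\<lambda>K::real. K \<ge> 1) at_top" by (rule eventually_ge_at_top)
  ultimately have "eventually (\<lambda>K::real. 64 * c * K ^ 4 < 2 powr (K * ln 2 / 2 - 9) \<and>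
      K * ln 2 / 2 \<ge> 9 \<and> K \<ge> 1) at_top" by eventually_elim simp
  then obtain K :: real where K: "64 * c * K ^ 4 < 2 powr (K * ln 2 / 2 - 9)" "K * ln 2 / 2 \<ge> 9" "K \<ge> 1"
    by (metis (mono_tags, lifting) eventually_at_top_linorder order_refl)
  show ?thesis
  \<comment> \<open>The factor 2 pays for rounding \<open>s\<close> up, since
    \<open>K * q * ln q \<ge> 1\<close>.\<close>
  proof (intro exI[of _ "2 * K"] conjI allI impI)
    show "2 * K > 0" using K by simp
    fix q :: real assume q: "q \<ge> 2"
    define s where "s = nat \<lceil>K * q * ln q\<rceil>"
    define h where "h = nat \<lfloor>s / q / 2\<rfloor>"
    have "ln 2 \<ge> (1/2::real)" using ln2_ge_two_thirds by simp
    moreover have "ln q \<ge> ln 2" using q by simp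
    ultimately have L: "ln q \<ge> 1/2" by linarith
    have "1 * 1 \<le> K * (q * ln q)"
      using mult_mono[OF q L] K(3) q by (intro mult_mono) auto
    then have KqL: "K * q * ln q \<ge> 1" by (simp add: mult.assoc)
    have s1: "real s \<ge> K * q * ln q" unfolding s_def by linarith
    have s2: "real s \<le> 2 * K * q * ln q" using KqL unfolding s_def by linarith
    have spos: "s > 0" using s1 KqL by linarith
    have h1: "real h \<le> s / q / 2" using q unfolding h_def by (simp add: le_floor_iff)
    have "K * ln q / 2 \<le> s / q / 2" using s1 q by (simp add: field_simps)
    then have h2: "real h \<ge> K * ln q / 2 - 1" unfolding h_def by linarith
    have "q powr (K * ln 2 / 2) = 2 powr (K * ln q / 2)" using q by (simp add: powr_def mult.commute)
    then have "q powr (K * ln 2 / 2) / 2 = 2 powr (K * ln q / 2 - 1)" by (simp add: powr_diff)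
    also have "\<dots> \<le> 2 powr real h" using h2 by (intro powr_mono) auto
    also have "\<dots> = 2 ^ h" by (simp add: powr_realpow)
    finally have two: "q powr (K * ln 2 / 2) / 2 \<le> 2 ^ h" .
    have "ln q \<le> q" using q ln_bound by simp
    then have "2 * K * q * ln q \<le> 2 * K * q * q" using K q by (intro mult_left_mono) auto
    then have "real s \<le> 2 * K * q\<^sup>2" using s2 by (simp add: power2_eq_square mult.assoc)
    then have "real s ^ 4 \<le> (2 * K * q\<^sup>2) ^ 4" by (intro power_mono) auto
    also have "\<dots> = 16 * K ^ 4 * q ^ 8" by (simp add: power_mult_distrib flip: power_mult)
    finally have "2 * (c * real s ^ 4) \<le> 2 * (c * (16 * K ^ 4 * q ^ 8))" using c by (intro mult_left_mono) auto
    also have "\<dots> = (64 * c * K ^ 4) * (q ^ 8 / 2)" by simp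
    also have "\<dots> < 2 powr (K * ln 2 / 2 - 9) * (q ^ 8 / 2)" using K(1) q by (intro mult_strict_right_mono) auto
    also have "\<dots> \<le> q powr (K * ln 2 / 2 - 9) * (q ^ 8 / 2)" using K(2) q
      by (intro mult_right_mono powr_mono2) auto
    also have "\<dots> = q powr (K * ln 2 / 2) / 2 / q"
    proof -
      have "q powr (K * ln 2 / 2 - 9) = q powr (K * ln 2 / 2) / q ^ 9"
        using q powr_realpow[of q 9] by (simp add: powr_diff)
      moreover have "q ^ 9 = q ^ 8 * q" by (simp add: power_Suc2[symmetric] del: power_Suc2)
      ultimately show ?thesis using q by simp
    qed
    also have "\<dots> \<le> 2 ^ h / q" using two q by (intro divide_right_mono) auto
    finally show "\<exists>s h :: nat. s > 0 \<and> real s \<le> 2 * K * q * ln q \<and> real h \<le> s / q / 2 \<and>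
      2 * (c * real s ^ 4) < 2 ^ h / q" using spos s2 h1 by blast
  qed
qed

text \<open>The double sampling lemma with \<open>\<epsilon> = 1 / q\<close>, applied to the heavy
  intervals at all times together. A single finite set serves all times because the number of traces
  is bounded uniformly over \<open>t\<close>, \<open>u\<close>, \<open>v\<close>.\<close>

lemma kinetic_interval_net:
  fixes D :: nat
  shows "\<exists>K>0. \<forall>(X :: 'a set) a b (q::real). finite X \<and> q \<ge> 2 \<and>
      (\<forall>x\<in>X. degree (a x) \<le> D \<and> degree (b x) \<le> D) \<longrightarrow>
    (\<exists>S\<subseteq>X. real (card S) \<le> K * q * ln q \<and>
      (\<forall>t u v. real (card (kinetic_interval X a b t u v)) > card X / q \<longrightarrow>
        S \<inter> kinetic_interval X a b t u v \<noteq> {}))"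
proof -
  \<comment> \<open>The trace bound for \<open>2 * s\<close> elements, with
    \<open>(2 * s) ^ 4 = 16 * s ^ 4\<close>.\<close>
  define c where "c = (16 * D + 5) * 16"
  obtain K where K: "K > 0" "\<And>q. q \<ge> 2 \<Longrightarrow> \<exists>s h :: nat. s > 0 \<and> real s \<le> K * q * ln q \<and> real h \<le> s / q / 2 \<and>
    2 * (real c * real s ^ 4) < 2 ^ h / q" using sample_size_exists[of "real c"] by (auto simp: c_def)
  show ?thesis
  proof (intro exI[of _ K] conjI K(1) allI impI; elim conjE)
    fix X :: "'a set" and a b :: "'a \<Rightarrow> real poly" and q :: real
    assume X: "finite X" and q: "q \<ge> 2" and deg: "\<forall>x\<in>X. degree (a x) \<le> D \<and> degree (b x) \<le> D"
    show "\<exists>S\<subseteq>X. real (card S) \<le> K * q * ln q \<and>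
      (\<forall>t u v. real (card (kinetic_interval X a b t u v)) > card X / q \<longrightarrow>
        S \<inter> kinetic_interval X a b t u v \<noteq> {})"
    proof (cases "X = {}")
      case True
      have "kinetic_interval X a b t u v = {}" for t u v using True by (simp add: kinetic_interval_def)
      then show ?thesis using True K(1) q by (intro exI[of _ "{}"]) (simp add: mult_nonneg_nonneg)
    next
      case False
      obtain s h :: nat where sh: "s > 0" "real s \<le> K * q * ln q" "real h \<le> s / q / 2"
        "2 * (real c * real s ^ 4) < 2 ^ h / q" using K(2)[OF q] by blast
      define F where "F = {R. \<exists>t u v. R = kinetic_interval X a b t u v \<and> card R > card X / q}"
      have trace: "card ((\<lambda>R. R \<inter> Y) ` F) \<le> c * s ^ 4" if Y: "Y \<subseteq> X" "card Y \<le> 2 * s" for Y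
      proof (cases "Y = {}")
        case True
        then have "(\<lambda>R. R \<inter> Y) ` F \<subseteq> {{}}" by auto
        then have "card ((\<lambda>R. R \<inter> Y) ` F) \<le> card {{} :: 'a set}" by (rule card_mono[rotated]) simp
        also have "\<dots> \<le> c * s ^ 4" using sh(1) by (simp add: c_def Suc_le_eq)
        finally show ?thesis .
      next
        case False
        have fY: "finite Y" using finite_subset[OF Y(1) X] .
        have "kinetic_interval X a b t u v \<inter> Y = kinetic_interval Y a b t u v" for t u v
          using Y(1) by (auto simp: kinetic_interval_def)
        then have sub: "(\<lambda>R. R \<inter> Y) ` F \<subseteq> {kinetic_interval Y a b t u v | t u v. True}"
          unfolding F_def by (auto, blast)
        have dY: "\<forall>x\<in>Y. degree (a x) \<le> D \<and> degree (b x) \<le> D" using Y deg by blast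
        have "card ((\<lambda>R. R \<inter> Y) ` F) \<le> (16 * D + 5) * card Y ^ 4"
          using card_mono[OF card_kinetic_interval_traces_le(1)[OF fY False dY] sub]
            card_kinetic_interval_traces_le(2)[OF fY False dY] by linarith
        also have "\<dots> \<le> (16 * D + 5) * (2 * s) ^ 4" using Y(2) by (intro mult_left_mono power_mono) auto
        also have "\<dots> = c * s ^ 4" by (simp add: c_def power_mult_distrib)
        finally show ?thesis .
      qed
      have "\<exists>S\<subseteq>X. card S \<le> s \<and> (\<forall>R\<in>F. S \<inter> R \<noteq> {})"
      proof (rule hitting_set_of_trace_bound[OF X False sh(1)])
        show "R \<subseteq> X \<and> 1 / q * card X \<le> card R" if "R \<in> F" for R
          using that by (auto simp: F_def kinetic_interval_def)
      qed (use trace sh q in auto)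
      then obtain S where S: "S \<subseteq> X" "card S \<le> s" "\<forall>R\<in>F. S \<inter> R \<noteq> {}" by blast
      have "S \<inter> kinetic_interval X a b t u v \<noteq> {}"
        if "real (card (kinetic_interval X a b t u v)) > card X / q" for t u v
        using S(3) that unfolding F_def by blast
      then show ?thesis using S sh(2) by (intro exI[of _ S]) auto
    qed
  qed
qed

section \<open>Simplices and coordinate flats\<close>

text \<open>
  Fraction-free Gaussian elimination. Here \<open>z i j\<close> is the \<open>j\<close>-th coordinate of the \<open>i\<close>-th vertex, and
  \<open>flat_form z k c\<close> is a linear form in the coordinates \<open>0, \<dots>, k - 1, c\<close> of \<open>y\<close> and the homogenising
  variable \<open>w\<close> that vanishes at the vertices \<open>0, \<dots>, k\<close>. The coefficient of \<open>y c\<close> is \<open>flat_lead z k\<close>,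
  whatever \<open>c\<close> is.
\<close>

fun flat_form :: "(nat \<Rightarrow> nat \<Rightarrow> 'r::comm_ring_1) \<Rightarrow> nat \<Rightarrow> nat \<Rightarrow> (nat \<Rightarrow> 'r) \<Rightarrow> 'r \<Rightarrow> 'r" where
  "flat_form z 0 c y w = y c - z 0 c * w"
| "flat_form z (Suc k) c y w =
     flat_form z k k (z (Suc k)) 1 * flat_form z k c y w - flat_form z k c (z (Suc k)) 1 * flat_form z k k y w"

fun flat_lead :: "(nat \<Rightarrow> nat \<Rightarrow> 'r::comm_ring_1) \<Rightarrow> nat \<Rightarrow> 'r" where
  "flat_lead z 0 = 1"
| "flat_lead z (Suc k) = flat_form z k k (z (Suc k)) 1 * flat_lead z k"

text \<open>Induction along the elimination. For \<open>c = k\<close> and a nonzero lead, the zero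
  set at \<open>w = 1\<close> is thus a hyperplane in the coordinates \<open>0, ..., k\<close>, and
  the equation can be solved for coordinate \<open>k\<close>.\<close>

lemma flat_form_linear:
  "\<exists>h g. \<forall>y w. flat_form z k c y w = (\<Sum>i<k. h i * y i) + flat_lead z k * y c + g * w"
proof (induction k arbitrary: c)
  case 0
  show ?case by (intro exI[of _ "\<lambda>_. 0"] exI[of _ "- z 0 c"]) (simp add: algebra_simps)
next
  case (Suc k)
  obtain h g where h: "\<And>y w. flat_form z k c y w = (\<Sum>i<k. h i * y i) + flat_lead z k * y c + g * w"
    using Suc[of c] by blast
  obtain h' g' where h': "\<And>y w. flat_form z k k y w = (\<Sum>i<k. h' i * y i) + flat_lead z k * y k + g' * w"
    using Suc[of k] by blast
  define \<alpha> where "\<alpha> = flat_form z k k (z (Suc k)) 1"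
  define \<beta> where "\<beta> = flat_form z k c (z (Suc k)) 1"
  have "flat_form z (Suc k) c y w =
      (\<Sum>i<Suc k. (if i < k then \<alpha> * h i - \<beta> * h' i else - \<beta> * flat_lead z k) * y i) +
      flat_lead z (Suc k) * y c + (\<alpha> * g - \<beta> * g') * w" for y w
  proof -
    have "flat_form z (Suc k) c y w = \<alpha> * flat_form z k c y w - \<beta> * flat_form z k k y w"
      by (simp add: \<alpha>_def \<beta>_def)
    also have "\<dots> = (\<Sum>i<k. (\<alpha> * h i - \<beta> * h' i) * y i) - \<beta> * flat_lead z k * y k + \<alpha> * flat_lead z k * y c
        + (\<alpha> * g - \<beta> * g') * w"
      unfolding h h' by (simp add: algebra_simps sum_distrib_left sum_subtractf)
    finally show ?thesis by (simp add: \<alpha>_def)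
  qed
  then show ?case
    by (intro exI[of _ "\<lambda>i. if i < k then \<alpha> * h i - \<beta> * h' i else - \<beta> * flat_lead z k"]
        exI[of _ "\<alpha> * g - \<beta> * g'"] allI)
qed

text \<open>At the newest vertex the two products of the elimination step coincide; at an older one
  each contains a vanishing factor.\<close>

lemma flat_form_vertex: "i \<le> k \<Longrightarrow> flat_form z k c (z i) 1 = 0"
proof (induction k arbitrary: c)
  case (Suc k)
  then show ?case by (cases "i = Suc k") (simp_all add: mult.commute)
qed simp

lemma flat_form_cong_vertices:
  "(\<And>i. i \<le> k \<Longrightarrow> z i = z' i) \<Longrightarrow> flat_form z k c y w = flat_form z' k c y w"
  by (induction k arbitrary: c y w) simp_all

lemma flat_lead_cong_vertices:
  assumes "\<And>i. i \<le> k \<Longrightarrow> z i = z' i"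
  shows "flat_lead z k = flat_lead z' k"
  using assms
proof (induction k)
  case (Suc k)
  have "flat_form z k k (z (Suc k)) 1 = flat_form z' k k (z (Suc k)) 1"
    using Suc.prems by (intro flat_form_cong_vertices) simp
  moreover have "flat_lead z k = flat_lead z' k" using Suc by simp
  ultimately show ?case using Suc.prems[of "Suc k"] by simp
qed simp

lemma flat_form_cong_point:
  assumes "\<And>i. i < k \<Longrightarrow> y i = y' i" "y c = y' c"
  shows "flat_form z k c y w = flat_form z k c y' w"
proof -
  obtain h g where "\<And>y w. flat_form z k c y w = (\<Sum>i<k. h i * y i) + flat_lead z k * y c + g * w"
    using flat_form_linear[of z k c] by blast
  then show ?thesis using assms by simp
qed

text \<open>Homogeneity is what later allows denominators to be cleared.\<close>

lemma flat_form_scale: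
  "flat_form z k c (\<lambda>i. u * y i) (u * w) = u * flat_form z k c y w"
proof -
  obtain h g where "\<And>y w. flat_form z k c y w = (\<Sum>i<k. h i * y i) + flat_lead z k * y c + g * w"
    using flat_form_linear[of z k c] by blast
  then show ?thesis by (simp add: algebra_simps sum_distrib_left)
qed

lemma poly_flat_form:
  "poly (flat_form z k c y w) t = flat_form (\<lambda>i j. poly (z i j) t) k c (\<lambda>j. poly (y j) t) (poly w t)"
  by (induction k arbitrary: c y w) simp_all

lemma poly_flat_lead:
  "poly (flat_lead z k) t = flat_lead (\<lambda>i j. poly (z i j) t) k"
  by (induction k) (simp_all add: poly_flat_form)

text \<open>Each elimination step multiplies two forms of the previous stage, so the bound
  doubles.\<close>

lemma degree_flat_form_le:
  fixes z :: "nat \<Rightarrow> nat \<Rightarrow> real poly"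
  assumes "\<And>i j. i \<le> k \<Longrightarrow> degree (z i j) \<le> \<gamma>" "\<And>j. degree (y j) \<le> \<gamma>" "degree w \<le> \<gamma>"
  shows "degree (flat_form z k c y w) \<le> 2 ^ Suc k * \<gamma>"
  using assms
proof (induction k arbitrary: c y w)
  case 0
  have "degree (z 0 c * w) \<le> \<gamma> + \<gamma>" using degree_mult_le[of "z 0 c" w] 0(1)[of 0 c] 0(3) by simp
  moreover have "degree (y c) \<le> \<gamma> + \<gamma>" using 0(2)[of c] by simp
  ultimately show ?case by (simp add: degree_diff_le mult_2)
next
  case (Suc k)
  have IH: "degree (flat_form z k c' y' w') \<le> 2 ^ Suc k * \<gamma>"
    if "\<And>j. degree (y' j) \<le> \<gamma>" "degree w' \<le> \<gamma>" for c' y' w'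
    using that Suc.prems(1) by (intro Suc.IH) simp_all
  have zd: "degree (z (Suc k) j) \<le> \<gamma>" for j using Suc.prems(1) by simp
  have m: "degree (p * p') \<le> 2 ^ Suc (Suc k) * \<gamma>"
    if "degree p \<le> 2 ^ Suc k * \<gamma>" "degree p' \<le> 2 ^ Suc k * \<gamma>" for p p' :: "real poly"
    using that degree_mult_le[of p p'] by simp
  show ?case unfolding flat_form.simps
    using zd Suc.prems by (intro degree_diff_le m IH) auto
qed

lemma degree_flat_lead_le:
  fixes z :: "nat \<Rightarrow> nat \<Rightarrow> real poly"
  assumes "\<And>i j. i \<le> k \<Longrightarrow> degree (z i j) \<le> \<gamma>"
  shows "degree (flat_lead z k) \<le> 2 ^ Suc k * \<gamma>"
  using assms
proof (induction k)
  case (Suc k)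
  have "degree (flat_form z k k (z (Suc k)) 1) \<le> 2 ^ Suc k * \<gamma>"
    using Suc.prems by (intro degree_flat_form_le) auto
  moreover have "degree (flat_lead z k) \<le> 2 ^ Suc k * \<gamma>" using Suc by simp
  ultimately show ?case
    using degree_mult_le[of "flat_form z k k (z (Suc k)) 1" "flat_lead z k"] by simp
qed simp

section \<open>Simplices meeting a coordinate flat, and degenerate tuples\<close>

definition simplex_meets_flat :: "nat \<Rightarrow> (nat \<Rightarrow> nat \<Rightarrow> real) \<Rightarrow> (nat \<Rightarrow> real) \<Rightarrow> bool" where
  "simplex_meets_flat k z s \<longleftrightarrow>
     (\<exists>\<mu>. (\<forall>i\<le>k. 0 \<le> \<mu> i) \<and> (\<Sum>i\<le>k. \<mu> i) = 1 \<and> (\<forall>j<k. (\<Sum>i\<le>k. \<mu> i * z i j) = s j))"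

text \<open>A form that is affine and vanishes at all vertices vanishes at their combination; this
  is solved for coordinate \<open>k\<close>. Setting that coordinate to 0 leaves the remaining terms
  of the form.\<close>

lemma flat_lead_times_height:
  fixes z :: "nat \<Rightarrow> nat \<Rightarrow> real"
  assumes "(\<Sum>i\<le>k. \<mu> i) = 1" "\<And>j. j < k \<Longrightarrow> (\<Sum>i\<le>k. \<mu> i * z i j) = s j"
  shows "flat_lead z k * (\<Sum>i\<le>k. \<mu> i * z i k) = - flat_form z k k (s(k := 0)) 1"
proof -
  obtain h g where h: "\<And>y w. flat_form z k k y w = (\<Sum>i<k. h i * y i) + flat_lead z k * y k + g * w"
    using flat_form_linear[of z k k] by blast
  have "0 = (\<Sum>i\<le>k. \<mu> i * flat_form z k k (z i) 1)" by (simp add: flat_form_vertex)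
  also have "\<dots> = (\<Sum>i\<le>k. (\<Sum>j<k. h j * (\<mu> i * z i j)) + flat_lead z k * (\<mu> i * z i k) + g * \<mu> i)"
    unfolding h by (simp add: algebra_simps sum_distrib_left)
  also have "\<dots> = (\<Sum>i\<le>k. \<Sum>j<k. h j * (\<mu> i * z i j)) + flat_lead z k * (\<Sum>i\<le>k. \<mu> i * z i k) + g * (\<Sum>i\<le>k. \<mu> i)"
    by (simp add: sum.distrib sum_distrib_left)
  also have "(\<Sum>i\<le>k. \<Sum>j<k. h j * (\<mu> i * z i j)) = (\<Sum>j<k. h j * (\<Sum>i\<le>k. \<mu> i * z i j))"
    by (subst sum.swap) (simp add: sum_distrib_left)
  also have "\<dots> = (\<Sum>j<k. h j * s j)" using assms(2) by simp
  finally show ?thesis using assms(1) by (simp add: h)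
qed

text \<open>The lead of a longer tuple vanishes only if that of the shorter one does or the new
  vertex satisfies the equation of \<open>flat_form\<close>. When the shorter lead is nonzero, this
  equation defines a hyperplane, leaving at most \<open>M\<close> choices.\<close>

lemma card_degenerate_tuples_le:
  fixes x :: "'a \<Rightarrow> nat \<Rightarrow> real"
  assumes Q: "finite Q" and k: "k \<le> d"
    and hyp: "\<And>h c. (\<exists>j<d. h j \<noteq> 0) \<Longrightarrow> card {q\<in>Q. (\<Sum>j<d. h j * x q j) = c} \<le> M"
  shows "card {\<sigma> \<in> {..k} \<rightarrow>\<^sub>E Q. flat_lead (\<lambda>i. x (\<sigma> i)) k = 0} \<le> k * M * card Q ^ k"
  using k
proof (induction k)
  case (Suc k)
  define B where "B = (\<lambda>\<sigma>. {q\<in>Q. flat_form (\<lambda>i. x (\<sigma> i)) k k (x q) 1 = 0})"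
  define T where "T = {..k} \<rightarrow>\<^sub>E Q"
  define T0 where "T0 = {\<sigma> \<in> T. flat_lead (\<lambda>i. x (\<sigma> i)) k = 0}"
  have fT: "finite T" and cT: "card T = card Q ^ Suc k"
    using Q by (auto simp: T_def card_PiE intro!: finite_PiE)
  have cB: "card (B \<sigma>) \<le> M" if lead: "flat_lead (\<lambda>i. x (\<sigma> i)) k \<noteq> 0" for \<sigma>
  proof -
    obtain h g where h: "\<And>y w. flat_form (\<lambda>i. x (\<sigma> i)) k k y w =
        (\<Sum>i<k. h i * y i) + flat_lead (\<lambda>i. x (\<sigma> i)) k * y k + g * w"
      using flat_form_linear[of "\<lambda>i. x (\<sigma> i)" k k] by blast
    \<comment> \<open>Padding with zeros gives a form in all \<open>d\<close> coordinates; the lead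
      at index \<open>k\<close> makes it nonzero.\<close>
    define h' where "h' = (\<lambda>j. if j < k then h j else if j = k then flat_lead (\<lambda>i. x (\<sigma> i)) k else 0)"
    have "(\<Sum>j<d. h' j * y j) = (\<Sum>i<k. h i * y i) + flat_lead (\<lambda>i. x (\<sigma> i)) k * y k" for y
    proof -
      have "(\<Sum>j<d. h' j * y j) = (\<Sum>j<Suc k. h' j * y j)"
        using Suc.prems by (intro sum.mono_neutral_right) (auto simp: h'_def)
      then show ?thesis by (simp add: h'_def)
    qed
    then have "B \<sigma> = {q\<in>Q. (\<Sum>j<d. h' j * x q j) = - g}"
      by (auto simp: B_def h)
    moreover have "\<exists>j<d. h' j \<noteq> 0" using lead Suc.prems by (intro exI[of _ k]) (simp add: h'_def)
    ultimately show ?thesis using hyp by simp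
  qed
  have "{\<sigma> \<in> {..Suc k} \<rightarrow>\<^sub>E Q. flat_lead (\<lambda>i. x (\<sigma> i)) (Suc k) = 0} \<subseteq>
      (\<lambda>(\<sigma>, q). \<sigma>(Suc k := q)) ` (T0 \<times> Q \<union> (SIGMA \<sigma>:T - T0. B \<sigma>))"
  proof
    fix \<sigma> assume s: "\<sigma> \<in> {\<sigma> \<in> {..Suc k} \<rightarrow>\<^sub>E Q. flat_lead (\<lambda>i. x (\<sigma> i)) (Suc k) = 0}"
    then have "\<sigma> \<in> (\<lambda>(y, g). g(Suc k := y)) ` (Q \<times> T)"
      by (simp add: T_def atMost_Suc PiE_insert_eq)
    then obtain \<tau> q where t: "\<tau> \<in> T" "q \<in> Q" "\<sigma> = \<tau>(Suc k := q)" by auto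
    have "flat_lead (\<lambda>i. x (\<sigma> i)) k = flat_lead (\<lambda>i. x (\<tau> i)) k"
      by (rule flat_lead_cong_vertices) (simp add: t)
    moreover have "flat_form (\<lambda>i. x (\<sigma> i)) k k (x q) 1 = flat_form (\<lambda>i. x (\<tau> i)) k k (x q) 1"
      by (rule flat_form_cong_vertices) (simp add: t)
    ultimately have "flat_lead (\<lambda>i. x (\<tau> i)) k = 0 \<or> flat_form (\<lambda>i. x (\<tau> i)) k k (x q) 1 = 0"
      using s by (auto simp: t(3))
    then have "(\<tau>, q) \<in> T0 \<times> Q \<union> (SIGMA \<sigma>:T - T0. B \<sigma>)"
      using t by (auto simp: T0_def B_def)
    then show "\<sigma> \<in> (\<lambda>(\<sigma>, q). \<sigma>(Suc k := q)) ` (T0 \<times> Q \<union> (SIGMA \<sigma>:T - T0. B \<sigma>))"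
      using t(3) by (auto intro: rev_image_eqI)
  qed
  moreover have fin: "finite (T0 \<times> Q \<union> (SIGMA \<sigma>:T - T0. B \<sigma>))"
    using fT Q by (auto simp: T0_def B_def)
  ultimately have "card {\<sigma> \<in> {..Suc k} \<rightarrow>\<^sub>E Q. flat_lead (\<lambda>i. x (\<sigma> i)) (Suc k) = 0} \<le>
      card (T0 \<times> Q \<union> (SIGMA \<sigma>:T - T0. B \<sigma>))"
    by (meson card_image_le card_mono finite_imageI order_trans)
  also have "\<dots> \<le> card (T0 \<times> Q) + card (SIGMA \<sigma>:T - T0. B \<sigma>)" by (rule card_Un_le)
  also have "card (SIGMA \<sigma>:T - T0. B \<sigma>) = (\<Sum>\<sigma>\<in>T - T0. card (B \<sigma>))"
    using fT Q by (subst card_SigmaI) (auto simp: B_def)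
  also have "\<dots> \<le> (\<Sum>\<sigma>\<in>T - T0. M)" by (intro sum_mono cB) (auto simp: T0_def)
  also have "\<dots> \<le> M * card Q ^ Suc k"
    using card_mono[OF fT, of "T - T0"] cT by (simp add: mult.commute)
  also have "card (T0 \<times> Q) \<le> k * M * card Q ^ k * card Q"
    using Suc by (simp add: card_cartesian_product T0_def T_def)
  finally show ?case by (simp add: algebra_simps)
qed simp

section \<open>Caratheodory's theorem in coordinates\<close>

text \<open>Gaussian elimination: a pivot \<open>l\<close> disposes of the last equation, leaving
  one equation and one unknown fewer.\<close>

lemma linear_dependence_exists:
  fixes A :: "'i \<Rightarrow> nat \<Rightarrow> real"
  assumes "finite I" "K < card I"
  shows "\<exists>\<nu>. (\<exists>i\<in>I. \<nu> i \<noteq> 0) \<and> (\<forall>j<K. (\<Sum>i\<in>I. \<nu> i * A i j) = 0)"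
  using assms
proof (induction K arbitrary: I A)
  case 0
  then show ?case by (intro exI[of _ "\<lambda>_. 1"]) (auto simp: card_gt_0_iff)
next
  case (Suc K)
  show ?case
  proof (cases "\<forall>i\<in>I. A i K = 0")
    case True
    obtain \<nu> where "\<exists>i\<in>I. \<nu> i \<noteq> 0" "\<forall>j<K. (\<Sum>i\<in>I. \<nu> i * A i j) = 0"
      using Suc.IH[of I A] Suc.prems by auto
    with True show ?thesis by (intro exI[of _ \<nu>]) (auto simp: less_Suc_eq)
  next
    case False
    then obtain l where l: "l \<in> I" "A l K \<noteq> 0" by blast
    define J where "J = I - {l}"
    have J: "finite J" "K < card J" "l \<notin> J" "I = insert l J" using Suc.prems l by (auto simp: J_def)
    obtain \<nu> where nu: "\<exists>i\<in>J. \<nu> i \<noteq> 0"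
      "\<And>j. j < K \<Longrightarrow> (\<Sum>i\<in>J. \<nu> i * (A i j - A i K / A l K * A l j)) = 0"
      using Suc.IH[OF J(1,2), of "\<lambda>i j. A i j - A i K / A l K * A l j"] by blast
    \<comment> \<open>The weight of the pivot is the one that the last equation forces.\<close>
    define \<nu>' where "\<nu>' = \<nu>(l := - (\<Sum>i\<in>J. \<nu> i * (A i K / A l K)))"
    have split: "(\<Sum>i\<in>I. \<nu>' i * A i j) = (\<Sum>i\<in>J. \<nu> i * (A i j - A i K / A l K * A l j))" for j
    proof -
      have "(\<Sum>i\<in>J. \<nu>' i * A i j) = (\<Sum>i\<in>J. \<nu> i * A i j)"
        using J(3) by (intro sum.cong) (auto simp: \<nu>'_def)
      then have "(\<Sum>i\<in>I. \<nu>' i * A i j) = (\<Sum>i\<in>J. \<nu> i * A i j) - (\<Sum>i\<in>J. \<nu> i * (A i K / A l K)) * A l j"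
        using J by (simp add: \<nu>'_def)
      also have "\<dots> = (\<Sum>i\<in>J. \<nu> i * A i j - \<nu> i * (A i K / A l K) * A l j)"
        by (simp add: sum_subtractf sum_distrib_right)
      finally show ?thesis by (simp add: right_diff_distrib mult.assoc)
    qed
    have "(\<Sum>i\<in>I. \<nu>' i * A i j) = 0" if "j < Suc K" for j
      using that nu(2)[of j] l(2) by (cases "j = K") (simp_all add: split)
    moreover have "\<exists>i\<in>I. \<nu>' i \<noteq> 0" using nu(1) J by (auto simp: \<nu>'_def)
    ultimately show ?thesis by blast
  qed
qed

text \<open>As long as more than \<open>K + 1\<close> points remain they are affinely dependent.
  Moving the weights along the dependence until one of them vanishes removes a point and keeps the
  combination.\<close>

lemma caratheodory_coordinates:
  fixes A :: "'i \<Rightarrow> nat \<Rightarrow> real"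
  assumes "finite I" "\<And>i. i \<in> I \<Longrightarrow> 0 \<le> \<mu> i" "(\<Sum>i\<in>I. \<mu> i) = 1" "\<And>j. j < K \<Longrightarrow> (\<Sum>i\<in>I. \<mu> i * A i j) = s j"
  shows "\<exists>J \<mu>'. J \<subseteq> I \<and> card J \<le> Suc K \<and> (\<forall>i\<in>J. 0 \<le> \<mu>' i) \<and> (\<Sum>i\<in>J. \<mu>' i) = 1 \<and>
    (\<forall>j<K. (\<Sum>i\<in>J. \<mu>' i * A i j) = s j)"
  using assms
proof (induction "card I" arbitrary: I \<mu> rule: less_induct)
  case less
  show ?case
  proof (cases "card I \<le> Suc K")
    case True
    with less.prems show ?thesis by blast
  next
    case False
    \<comment> \<open>Index 0 is the equation for the sum of the weights; it makes the dependence
      affine.\<close>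
    define A' where "A' = (\<lambda>i j. if j = 0 then 1 else A i (j - 1))"
    obtain \<nu>0 where nu0: "\<exists>i\<in>I. \<nu>0 i \<noteq> 0" "\<forall>j<Suc K. (\<Sum>i\<in>I. \<nu>0 i * A' i j) = 0"
      using linear_dependence_exists[of I "Suc K" A'] less.prems(1) False by auto
    have nu0s: "(\<Sum>i\<in>I. \<nu>0 i) = 0" using nu0(2)[rule_format, of 0] by (simp add: A'_def)
    have nu0A: "(\<Sum>i\<in>I. \<nu>0 i * A i j) = 0" if "j < K" for j
      using nu0(2)[rule_format, of "Suc j"] that by (simp add: A'_def)
    have "\<exists>i\<in>I. \<nu>0 i > 0"
    proof (rule ccontr)
      assume "\<not> ?thesis"
      then have "\<And>i. i \<in> I \<Longrightarrow> 0 \<le> - \<nu>0 i" by force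
      then have "\<forall>i\<in>I. - \<nu>0 i = 0"
        using sum_nonneg_eq_0_iff[of I "\<lambda>i. - \<nu>0 i"] less.prems(1) nu0s by (simp add: sum_negf)
      with nu0(1) show False by auto
    qed
    define Pp where "Pp = {i\<in>I. \<nu>0 i > 0}"
    have Pp: "finite Pp" "Pp \<noteq> {}" using less.prems(1) \<open>\<exists>i\<in>I. \<nu>0 i > 0\<close> by (auto simp: Pp_def)
    \<comment> \<open>The largest step that keeps all weights nonnegative; an index attaining the
      minimum gets weight 0.\<close>
    define \<theta> where "\<theta> = Min ((\<lambda>i. \<mu> i / \<nu>0 i) ` Pp)"
    have "\<theta> \<in> (\<lambda>i. \<mu> i / \<nu>0 i) ` Pp" using Pp by (simp add: \<theta>_def)
    then obtain l where l: "l \<in> Pp" "\<theta> = \<mu> l / \<nu>0 l" by blast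
    have th: "\<theta> \<le> \<mu> i / \<nu>0 i" if "i \<in> Pp" for i using that Pp by (simp add: \<theta>_def)
    have th0: "\<theta> \<ge> 0" using l less.prems(2) by (auto simp: Pp_def)
    define \<mu>1 where "\<mu>1 = (\<lambda>i. \<mu> i - \<theta> * \<nu>0 i)"
    have nn: "0 \<le> \<mu>1 i" if "i \<in> I" for i
    proof (cases "\<nu>0 i > 0")
      case True
      then show ?thesis using th[of i] that by (simp add: \<mu>1_def Pp_def field_simps)
    next
      case False
      then have "\<theta> * \<nu>0 i \<le> 0" using th0 by (simp add: mult_nonneg_nonpos)
      then show ?thesis using less.prems(2)[OF that] by (simp add: \<mu>1_def)
    qed
    have lI: "l \<in> I" and l0: "\<mu>1 l = 0" using l by (auto simp: Pp_def \<mu>1_def)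
    have rm: "(\<Sum>i\<in>I - {l}. \<mu>1 i * f i) = (\<Sum>i\<in>I. \<mu>1 i * f i)" for f
      using sum.remove[OF less.prems(1) lI, of "\<lambda>i. \<mu>1 i * f i"] l0 by simp
    have "\<exists>J \<mu>'. J \<subseteq> I - {l} \<and> card J \<le> Suc K \<and> (\<forall>i\<in>J. 0 \<le> \<mu>' i) \<and> (\<Sum>i\<in>J. \<mu>' i) = 1 \<and>
      (\<forall>j<K. (\<Sum>i\<in>J. \<mu>' i * A i j) = s j)"
    proof (rule less.hyps)
      show "card (I - {l}) < card I" using lI less.prems(1) by (meson card_Diff1_less)
      show "(\<Sum>i\<in>I - {l}. \<mu>1 i) = 1"
        using rm[of "\<lambda>_. 1"] less.prems(3) nu0s by (simp add: \<mu>1_def sum_subtractf flip: sum_distrib_left)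
      show "(\<Sum>i\<in>I - {l}. \<mu>1 i * A i j) = s j" if "j < K" for j
      proof -
        have "(\<Sum>i\<in>I. \<mu>1 i * A i j) = (\<Sum>i\<in>I. \<mu> i * A i j) - \<theta> * (\<Sum>i\<in>I. \<nu>0 i * A i j)"
          by (simp add: \<mu>1_def algebra_simps sum_subtractf sum_distrib_left)
        then show ?thesis using rm[of "\<lambda>i. A i j"] less.prems(4)[OF that] nu0A[OF that] by simp
      qed
    qed (use nn less.prems(1) in auto)
    then show ?thesis by blast
  qed
qed

section \<open>Quantiles\<close>

text \<open>\<open>u\<close> is the least value of \<open>f\<close> with at least a third of
  \<open>G\<close> at or below it; the next smaller value, if any, fails this.\<close>

lemma lower_quantile_exists:
  fixes f :: "'a \<Rightarrow> real"
  assumes G: "finite G" "G \<noteq> {}"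
  shows "\<exists>u. card G \<le> 3 * card {x\<in>G. f x \<le> u} \<and> 3 * card {x\<in>G. f x < u} < card G"
proof -
  define V where "V = {y \<in> f ` G. card G \<le> 3 * card {x\<in>G. f x \<le> y}}"
  have "f ` G \<noteq> {}" "finite (f ` G)" using G by auto
  then have "{x\<in>G. f x \<le> Max (f ` G)} = G" by auto
  then have "Max (f ` G) \<in> V" using G by (simp add: V_def)
  then have V: "V \<noteq> {}" "finite V" using G by (blast, simp add: V_def)
  define u where "u = Min V"
  have uV: "u \<in> V" using V by (simp add: u_def)
  have "3 * card {x\<in>G. f x < u} < card G"
  proof (cases "{x\<in>G. f x < u} = {}")
    case True
    then show ?thesis using G by (simp only: card.empty) (simp add: card_gt_0_iff)
  next
    case False
    define y where "y = Max (f ` {x\<in>G. f x < u})"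
    have "y \<in> f ` {x\<in>G. f x < u}" unfolding y_def using False G by (intro Max_in) auto
    then have y: "y \<in> f ` G" "y < u" by auto
    then have "y \<notin> V" using V by (auto simp: u_def)
    then have "3 * card {x\<in>G. f x \<le> y} < card G" using y by (simp add: V_def)
    moreover have "{x\<in>G. f x < u} \<subseteq> {x\<in>G. f x \<le> y}" using G by (auto simp: y_def)
    then have "card {x\<in>G. f x < u} \<le> card {x\<in>G. f x \<le> y}" using G by (intro card_mono) auto
    ultimately show ?thesis by linarith
  qed
  with uV show ?thesis by (auto simp: V_def)
qed

text \<open>Lower quantiles of \<open>f\<close> and of \<open>- f\<close>: fewer than a third lies
  strictly below \<open>u\<close>, fewer than a third strictly above \<open>v\<close>, and the rest
  lies between.\<close>

lemma middle_third_exists: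
  fixes f :: "'a \<Rightarrow> real"
  assumes G: "finite G" "G \<noteq> {}"
  obtains u v where "card G \<le> 3 * card {x\<in>G. f x \<le> u}" "card G \<le> 3 * card {x\<in>G. v \<le> f x}"
    "card G \<le> 3 * card {x\<in>G. u \<le> f x \<and> f x \<le> v}"
proof -
  obtain u where u: "card G \<le> 3 * card {x\<in>G. f x \<le> u}" "3 * card {x\<in>G. f x < u} < card G"
    using lower_quantile_exists[OF G, of f] by blast
  obtain v' where v': "card G \<le> 3 * card {x\<in>G. - f x \<le> v'}" "3 * card {x\<in>G. - f x < v'} < card G"
    using lower_quantile_exists[OF G, of "\<lambda>x. - f x"] by blast
  define v where "v = - v'"
  have iff: "- f x \<le> v' \<longleftrightarrow> v \<le> f x" "- f x < v' \<longleftrightarrow> v < f x" for x by (auto simp: v_def)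
  have v: "card G \<le> 3 * card {x\<in>G. v \<le> f x}" "3 * card {x\<in>G. v < f x} < card G"
    using v' by (simp_all only: iff)
  have "G \<subseteq> {x\<in>G. f x < u} \<union> {x\<in>G. v < f x} \<union> {x\<in>G. u \<le> f x \<and> f x \<le> v}" by auto
  then have "card G \<le> card ({x\<in>G. f x < u} \<union> {x\<in>G. v < f x} \<union> {x\<in>G. u \<le> f x \<and> f x \<le> v})"
    using G by (intro card_mono) auto
  also have "\<dots> \<le> card {x\<in>G. f x < u} + card {x\<in>G. v < f x} + card {x\<in>G. u \<le> f x \<and> f x \<le> v}"
    by (intro order_trans[OF card_Un_le] add_mono order_refl card_Un_le)
  finally have "card G \<le> 3 * card {x\<in>G. u \<le> f x \<and> f x \<le> v}" using u(2) v(2) by linarith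
  with u(1) v(1) show ?thesis by (rule that)
qed

section \<open>From one flat to the next by double counting\<close>

text \<open>A tuple is determined by its subtuple along \<open>g\<close> and its values at the other
  positions.\<close>

lemma card_tuples_with_subtuple_le:
  fixes I :: "'i set" and Q :: "'q set"
  assumes fin: "finite I" "finite Q" "finite G" and g: "inj_on g A" "g ` A \<subseteq> I"
  shows "card {w \<in> I \<rightarrow>\<^sub>E Q. (\<lambda>i\<in>A. w (g i)) \<in> G} \<le> card G * card Q ^ (card I - card A)"
proof -
  define W where "W = {w \<in> I \<rightarrow>\<^sub>E Q. (\<lambda>i\<in>A. w (g i)) \<in> G}"
  define F where "F = (\<lambda>w :: 'i \<Rightarrow> 'q. (\<lambda>i\<in>A. w (g i), restrict w (I - g ` A)))"
  have "inj_on F W"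
  proof (rule inj_onI)
    fix w w' assume w: "w \<in> W" "w' \<in> W" "F w = F w'"
    have eq: "(\<lambda>i\<in>A. w (g i)) = (\<lambda>i\<in>A. w' (g i))" "restrict w (I - g ` A) = restrict w' (I - g ` A)"
      using w(3) by (simp_all add: F_def)
    have "w i = w' i" if "i \<in> I" for i
    proof (cases "i \<in> g ` A")
      case True
      then obtain j where "j \<in> A" "i = g j" by blast
      then show ?thesis using fun_cong[OF eq(1), of j] by simp
    next
      case False
      then show ?thesis using fun_cong[OF eq(2), of i] that by simp
    qed
    moreover have "w i = w' i" if "i \<notin> I" for i
      using w(1,2) that by (auto simp: W_def PiE_iff extensional_def)
    ultimately show "w = w'" by (intro ext) blast
  qed
  moreover have "F ` W \<subseteq> G \<times> ((I - g ` A) \<rightarrow>\<^sub>E Q)" by (auto simp: F_def W_def)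
  moreover have "finite (G \<times> ((I - g ` A) \<rightarrow>\<^sub>E Q))" using fin by (auto intro!: finite_PiE)
  ultimately have "card W \<le> card (G \<times> ((I - g ` A) \<rightarrow>\<^sub>E Q))" by (rule card_inj_on_le)
  also have "\<dots> = card G * card Q ^ card (I - g ` A)"
    using fin by (simp add: card_cartesian_product card_PiE)
  also have "card (I - g ` A) = card I - card A"
    using fin g by (subst card_Diff_subset) (auto simp: card_image intro: finite_subset)
  finally show ?thesis by (simp add: W_def)
qed

text \<open>Caratheodory leaves at most \<open>K + 1\<close> indices; further indices of weight 0
  are added to reach exactly \<open>K + 1\<close>, so that \<open>g\<close> can be
  injective.\<close>

lemma simplex_meets_flat_of_hull:
  fixes A :: "'i \<Rightarrow> nat \<Rightarrow> real"
  assumes I: "finite I" "Suc K \<le> card I"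
    and mu: "\<And>i. i \<in> I \<Longrightarrow> 0 \<le> \<mu> i" "(\<Sum>i\<in>I. \<mu> i) = 1" "\<And>j. j < K \<Longrightarrow> (\<Sum>i\<in>I. \<mu> i * A i j) = s j"
  obtains g where "g \<in> {..K} \<rightarrow>\<^sub>E I" "inj_on g {..K}" "simplex_meets_flat K (\<lambda>i. A (g i)) s"
proof -
  obtain J \<mu>' where J: "J \<subseteq> I" "card J \<le> Suc K" "\<forall>i\<in>J. 0 \<le> \<mu>' i" "(\<Sum>i\<in>J. \<mu>' i) = 1"
    "\<forall>j<K. (\<Sum>i\<in>J. \<mu>' i * A i j) = s j"
    using caratheodory_coordinates[OF I(1), of \<mu> K A s] mu by blast
  obtain J' where J': "J \<subseteq> J'" "J' \<subseteq> I" "card J' = Suc K"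
    using exists_subset_between[OF J(2) I(2) J(1) I(1)] by blast
  have fJ': "finite J'" using J'(2) I(1) by (rule finite_subset)
  obtain g0 where g0: "bij_betw g0 {..K} J'"
    using finite_same_card_bij[of "{..K}" J'] J'(3) fJ' by auto
  define g where "g = restrict g0 {..K}"
  have g: "bij_betw g {..K} J'" using g0 by (simp add: g_def bij_betw_restrict_eq)
  define \<nu> where "\<nu> = (\<lambda>i. if i \<in> J then \<mu>' i else 0)"
  have tr: "(\<Sum>i\<le>K. \<nu> (g i) * f (g i)) = (\<Sum>i\<in>J. \<mu>' i * f i)" for f
  proof -
    have "(\<Sum>i\<le>K. \<nu> (g i) * f (g i)) = (\<Sum>i\<in>J'. \<nu> i * f i)"
      by (rule sum.reindex_bij_betw[OF g])
    also have "\<dots> = (\<Sum>i\<in>J. \<nu> i * f i)"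
      using J' fJ' by (intro sum.mono_neutral_right) (auto simp: \<nu>_def)
    finally show ?thesis by (simp add: \<nu>_def)
  qed
  have "simplex_meets_flat K (\<lambda>i. A (g i)) s" unfolding simplex_meets_flat_def
  proof (intro exI[of _ "\<lambda>i. \<nu> (g i)"] conjI)
    show "\<forall>i\<le>K. 0 \<le> \<nu> (g i)" using J(3) by (simp add: \<nu>_def)
    show "(\<Sum>i\<le>K. \<nu> (g i)) = 1" using tr[of "\<lambda>_. 1"] J(4) by simp
    show "\<forall>j<K. (\<Sum>i\<le>K. \<nu> (g i) * A (g i) j) = s j" using tr[of "\<lambda>i. A i j" for j] J(5) by simp
  qed
  moreover have "g \<in> {..K} \<rightarrow>\<^sub>E I"
    using bij_betw_imp_surj_on[OF g] J'(2) by (auto simp: g_def)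
  moreover have "inj_on g {..K}" using g by (rule bij_betw_imp_inj_on)
  ultimately show ?thesis using that by blast
qed

text \<open>The two points agree with \<open>s\<close> below coordinate \<open>k\<close> and their
  heights enclose \<open>s k\<close>, so the segment between them contains a point of that height.
  Disjoint index sets allow the weights to be merged.\<close>

lemma convex_combination_of_two_hulls:
  fixes s :: "nat \<Rightarrow> real"
  assumes "finite I" "finite J" "I \<inter> J = {}"
    and mu: "\<And>i. i \<in> I \<Longrightarrow> 0 \<le> \<mu> i" "(\<Sum>i\<in>I. \<mu> i) = 1" "\<And>j. j < k \<Longrightarrow> (\<Sum>i\<in>I. \<mu> i * A i j) = s j"
      "(\<Sum>i\<in>I. \<mu> i * A i k) \<le> s k"
    and nu: "\<And>i. i \<in> J \<Longrightarrow> 0 \<le> \<nu> i" "(\<Sum>i\<in>J. \<nu> i) = 1" "\<And>j. j < k \<Longrightarrow> (\<Sum>i\<in>J. \<nu> i * A i j) = s j"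
      "s k \<le> (\<Sum>i\<in>J. \<nu> i * A i k)"
  shows "\<exists>\<rho>. (\<forall>i\<in>I\<union>J. 0 \<le> \<rho> i) \<and> (\<Sum>i\<in>I\<union>J. \<rho> i) = 1 \<and> (\<forall>j<Suc k. (\<Sum>i\<in>I\<union>J. \<rho> i * A i j) = s j)"
proof -
  define a where "a = (\<Sum>i\<in>I. \<mu> i * A i k)"
  define b where "b = (\<Sum>i\<in>J. \<nu> i * A i k)"
  have "\<exists>\<theta>\<ge>0. \<theta> \<le> 1 \<and> (1 - \<theta>) * a + \<theta> * b = s k"
  proof (cases "a = b")
    case True
    then have "a = s k" using mu(4) nu(4) by (simp add: a_def b_def)
    then show ?thesis by (intro exI[of _ 0]) simp
  next
    case False
    then have ab: "a < b" using mu(4) nu(4) by (simp add: a_def b_def)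
    have "(1 - (s k - a) / (b - a)) * a + (s k - a) / (b - a) * b = s k"
    proof -
      have "(1 - (s k - a) / (b - a)) * a + (s k - a) / (b - a) * b = a + (s k - a) / (b - a) * (b - a)"
        by (simp only: algebra_simps)
      then show ?thesis using ab by simp
    qed
    then show ?thesis using ab mu(4) nu(4)
      by (intro exI[of _ "(s k - a) / (b - a)"]) (simp add: a_def b_def)
  qed
  then obtain \<theta> where th: "\<theta> \<ge> 0" "\<theta> \<le> 1" "(1 - \<theta>) * a + \<theta> * b = s k" by blast
  define \<rho> where "\<rho> = (\<lambda>i. if i \<in> I then (1 - \<theta>) * \<mu> i else \<theta> * \<nu> i)"
  have tr: "(\<Sum>i\<in>I\<union>J. \<rho> i * f i) = (1 - \<theta>) * (\<Sum>i\<in>I. \<mu> i * f i) + \<theta> * (\<Sum>i\<in>J. \<nu> i * f i)" for f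
  proof -
    have "(\<Sum>i\<in>I\<union>J. \<rho> i * f i) = (\<Sum>i\<in>I. \<rho> i * f i) + (\<Sum>i\<in>J. \<rho> i * f i)"
      using assms(1-3) by (rule sum.union_disjoint)
    moreover have "(\<Sum>i\<in>J. \<rho> i * f i) = (\<Sum>i\<in>J. \<theta> * \<nu> i * f i)"
      using assms(3) by (intro sum.cong) (auto simp: \<rho>_def)
    ultimately show ?thesis by (simp add: \<rho>_def sum_distrib_left mult.assoc)
  qed
  have "(\<Sum>i\<in>I\<union>J. \<rho> i * A i j) = s j" if "j < Suc k" for j
  proof (cases "j = k")
    case True
    then show ?thesis using th(3) by (simp add: tr a_def b_def)
  next
    case False
    then show ?thesis using that mu(3) nu(3) by (simp add: tr algebra_simps)
  qed
  moreover have "(\<Sum>i\<in>I\<union>J. \<rho> i) = 1" using tr[of "\<lambda>_. 1"] mu(2) nu(2) by simp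
  moreover have "\<forall>i\<in>I\<union>J. 0 \<le> \<rho> i" using th mu(1) nu(1) by (auto simp: \<rho>_def)
  ultimately show ?thesis by blast
qed

text \<open>A pair from \<open>L \<times> U\<close> is joined to a tuple of length
  \<open>2 * k + 2\<close> whose hull meets the next flat. Caratheodory picks \<open>k + 2\<close>
  of its positions spanning a simplex that already does. There are at most
  \<open>(2 * k + 2) ^ (k + 2)\<close> such choices \<open>g\<close>, and each serves a limited
  number of pairs.\<close>

lemma card_simplices_meeting_next_flat_ge:
  fixes x :: "'a \<Rightarrow> nat \<Rightarrow> real"
  assumes Q: "finite Q" and L: "L \<subseteq> {..k} \<rightarrow>\<^sub>E Q" and U: "U \<subseteq> {..k} \<rightarrow>\<^sub>E Q"
    and below: "\<And>\<sigma>. \<sigma> \<in> L \<Longrightarrow> \<exists>\<mu>. (\<forall>i\<le>k. 0 \<le> \<mu> i) \<and> (\<Sum>i\<le>k. \<mu> i) = 1 \<and>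
      (\<forall>j<k. (\<Sum>i\<le>k. \<mu> i * x (\<sigma> i) j) = s j) \<and> (\<Sum>i\<le>k. \<mu> i * x (\<sigma> i) k) \<le> s k"
    and above: "\<And>\<sigma>. \<sigma> \<in> U \<Longrightarrow> \<exists>\<mu>. (\<forall>i\<le>k. 0 \<le> \<mu> i) \<and> (\<Sum>i\<le>k. \<mu> i) = 1 \<and>
      (\<forall>j<k. (\<Sum>i\<le>k. \<mu> i * x (\<sigma> i) j) = s j) \<and> s k \<le> (\<Sum>i\<le>k. \<mu> i * x (\<sigma> i) k)"
  shows "card L * card U \<le> (2 * k + 2) ^ (k + 2) *
    (card {\<sigma> \<in> {..Suc k} \<rightarrow>\<^sub>E Q. simplex_meets_flat (Suc k) (\<lambda>i. x (\<sigma> i)) s} * card Q ^ k)"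
proof -
  define I where "I = {..<2 * k + 2}"
  define Gd where "Gd = {\<sigma> \<in> {..Suc k} \<rightarrow>\<^sub>E Q. simplex_meets_flat (Suc k) (\<lambda>i. x (\<sigma> i)) s}"
  define gs where "gs = {g \<in> {..Suc k} \<rightarrow>\<^sub>E I. inj_on g {..Suc k}}"
  define V where "V = (\<lambda>g. {w \<in> I \<rightarrow>\<^sub>E Q. (\<lambda>i\<in>{..Suc k}. w (g i)) \<in> Gd})"
  define join where "join = (\<lambda>(\<sigma> :: nat \<Rightarrow> 'a, \<tau>). \<lambda>i\<in>I. if i \<le> k then \<sigma> i else \<tau> (i - Suc k))"
  have fin: "finite I" "finite Gd" using Q by (auto simp: I_def Gd_def intro!: finite_PiE)
  have gsfin: "finite ({..Suc k} \<rightarrow>\<^sub>E I)" using fin by (intro finite_PiE) auto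
  have inj: "inj_on join (L \<times> U)"
  proof (rule inj_onI, clarify)
    fix \<sigma> \<tau> \<sigma>' \<tau>' assume h: "\<sigma> \<in> L" "\<tau> \<in> U" "\<sigma>' \<in> L" "\<tau>' \<in> U" "join (\<sigma>, \<tau>) = join (\<sigma>', \<tau>')"
    have "\<sigma> i = \<sigma>' i" if "i \<in> {..k}" for i
      using fun_cong[OF h(5), of i] that by (simp add: join_def I_def)
    moreover have "\<tau> i = \<tau>' i" if "i \<in> {..k}" for i
      using fun_cong[OF h(5), of "i + Suc k"] that by (simp add: join_def I_def)
    ultimately show "\<sigma> = \<sigma>' \<and> \<tau> = \<tau>'"
      using PiE_ext[of \<sigma> "{..k}" "\<lambda>_. Q" \<sigma>'] PiE_ext[of \<tau> "{..k}" "\<lambda>_. Q" \<tau>'] h(1-4) L U by blast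
  qed
  have sub: "join ` (L \<times> U) \<subseteq> (\<Union>g\<in>gs. V g)"
  proof (clarify)
    fix \<sigma> \<tau> assume st: "\<sigma> \<in> L" "\<tau> \<in> U"
    define w where "w = join (\<sigma>, \<tau>)"
    obtain \<mu> where mu: "\<forall>i\<le>k. 0 \<le> \<mu> i" "(\<Sum>i\<le>k. \<mu> i) = 1"
      "\<forall>j<k. (\<Sum>i\<le>k. \<mu> i * x (\<sigma> i) j) = s j" "(\<Sum>i\<le>k. \<mu> i * x (\<sigma> i) k) \<le> s k"
      using below[OF st(1)] by blast
    obtain \<nu> where nu: "\<forall>i\<le>k. 0 \<le> \<nu> i" "(\<Sum>i\<le>k. \<nu> i) = 1"
      "\<forall>j<k. (\<Sum>i\<le>k. \<nu> i * x (\<tau> i) j) = s j" "s k \<le> (\<Sum>i\<le>k. \<nu> i * x (\<tau> i) k)"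
      using above[OF st(2)] by blast
    define J where "J = {Suc k..<2 * k + 2}"
    have wl: "w i = \<sigma> i" if "i \<le> k" for i using that by (simp add: w_def join_def I_def)
    have wu: "w (i + Suc k) = \<tau> i" if "i \<le> k" for i using that by (simp add: w_def join_def I_def)
    have IJ: "{..k} \<union> J = I" by (auto simp: I_def J_def)
    have bij: "bij_betw (\<lambda>i. i + Suc k) {..k} J"
      by (rule bij_betwI[where g = "\<lambda>i. i - Suc k"]) (auto simp: J_def)
    have shift: "(\<Sum>i\<in>J. \<nu> (i - Suc k) * f (w i)) = (\<Sum>i\<le>k. \<nu> i * f (\<tau> i))" for f :: "'a \<Rightarrow> real"
    proof -
      have "(\<Sum>i\<in>J. \<nu> (i - Suc k) * f (w i)) = (\<Sum>i\<le>k. \<nu> (i + Suc k - Suc k) * f (w (i + Suc k)))"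
        by (rule sum.reindex_bij_betw[OF bij, symmetric])
      then show ?thesis by (simp add: wu del: add_Suc_right)
    qed
    have "\<exists>\<rho>. (\<forall>i\<in>{..k}\<union>J. 0 \<le> \<rho> i) \<and> (\<Sum>i\<in>{..k}\<union>J. \<rho> i) = 1 \<and>
        (\<forall>j<Suc k. (\<Sum>i\<in>{..k}\<union>J. \<rho> i * x (w i) j) = s j)"
    proof (rule convex_combination_of_two_hulls[where \<mu> = \<mu> and \<nu> = "\<lambda>i. \<nu> (i - Suc k)"])
      show "(\<Sum>i\<in>J. \<nu> (i - Suc k)) = 1" using shift[of "\<lambda>_. 1"] nu(2) by simp
      show "(\<Sum>i\<in>J. \<nu> (i - Suc k) * x (w i) j) = s j" if "j < k" for j
        using shift[of "\<lambda>q. x q j"] nu(3) that by simp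
      show "s k \<le> (\<Sum>i\<in>J. \<nu> (i - Suc k) * x (w i) k)" using shift[of "\<lambda>q. x q k"] nu(4) by simp
    qed (use mu nu(1) wl in \<open>auto simp: J_def\<close>)
    then obtain \<rho> where rho: "\<forall>i\<in>I. 0 \<le> \<rho> i" "(\<Sum>i\<in>I. \<rho> i) = 1"
      "\<forall>j<Suc k. (\<Sum>i\<in>I. \<rho> i * x (w i) j) = s j" unfolding IJ by blast
    obtain g where g: "g \<in> {..Suc k} \<rightarrow>\<^sub>E I" "inj_on g {..Suc k}"
      "simplex_meets_flat (Suc k) (\<lambda>i. x (w (g i))) s"
    proof (rule simplex_meets_flat_of_hull[where I = I and K = "Suc k" and \<mu> = \<rho> and A = "\<lambda>i. x (w i)" and s = s])
    qed (use rho in \<open>auto simp: I_def\<close>)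
    have wQ: "w \<in> I \<rightarrow>\<^sub>E Q"
      using st L U by (fastforce simp: w_def join_def I_def PiE_iff)
    have "simplex_meets_flat (Suc k) (\<lambda>i. x (if i \<le> Suc k then w (g i) else undefined)) s"
      using g(3) unfolding simplex_meets_flat_def by simp
    then have "(\<lambda>i\<in>{..Suc k}. w (g i)) \<in> Gd"
      using g(1) wQ by (auto simp: Gd_def restrict_def PiE_iff extensional_def)
    then have "w \<in> V g" using wQ by (simp add: V_def)
    then show "join (\<sigma>, \<tau>) \<in> (\<Union>g\<in>gs. V g)" using g by (auto simp: gs_def w_def)
  qed
  have "card L * card U = card (join ` (L \<times> U))"
    by (simp add: card_image[OF inj] card_cartesian_product)
  also have "\<dots> \<le> card (\<Union>g\<in>gs. V g)"
    using sub gsfin fin Q by (intro card_mono) (auto simp: gs_def V_def intro!: finite_PiE)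
  also have "\<dots> \<le> (\<Sum>g\<in>gs. card (V g))"
    using gsfin by (intro card_UN_le) (simp add: gs_def)
  also have "\<dots> \<le> (\<Sum>g\<in>gs. card Gd * card Q ^ k)"
  proof (rule sum_mono)
    fix g assume "g \<in> gs"
    then have "card (V g) \<le> card Gd * card Q ^ (card I - card {..Suc k})"
      unfolding V_def using fin Q by (intro card_tuples_with_subtuple_le) (auto simp: gs_def)
    \<comment> \<open>Of the \<open>2 * k + 2\<close> positions, \<open>k + 2\<close> are governed
      by \<open>g\<close> and \<open>k\<close> remain free.\<close>
    then show "card (V g) \<le> card Gd * card Q ^ k" by (simp add: I_def)
  qed
  also have "\<dots> = card gs * (card Gd * card Q ^ k)" by simp
  also have "card gs \<le> card ({..Suc k} \<rightarrow>\<^sub>E I)" using gsfin by (intro card_mono) (auto simp: gs_def)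
  also have "\<dots> = (2 * k + 2) ^ (k + 2)" by (simp add: card_PiE I_def)
  finally show ?thesis unfolding Gd_def by simp
qed

section \<open>Choosing the coordinates\<close>

text \<open>By \<open>large\<close> at least half of the counted tuples are nondegenerate. A third
  of those, hence \<open>c / 6\<close>, has its height \<open>f\<close> in the middle interval, and
  as many lie at or below, and at or above, each \<open>y\<close> in it. Pairing the last two kinds
  gives \<open>c\<^sup>2 / 36\<close>, divided by the number of Caratheodory choices.\<close>

lemma middle_interval_exists:
  fixes x :: "'a \<Rightarrow> nat \<Rightarrow> real" and c :: real
  assumes Q: "finite Q" "Q \<noteq> {}" and k: "k < d" and c: "c > 0"
    and hyp: "\<And>h e. (\<exists>j<d. h j \<noteq> 0) \<Longrightarrow> card {q\<in>Q. (\<Sum>j<d. h j * x q j) = e} \<le> M"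
    and many: "c * real (card Q) ^ Suc k \<le>
      card {\<sigma> \<in> {..k} \<rightarrow>\<^sub>E Q. simplex_meets_flat k (\<lambda>i. x (\<sigma> i)) s}"
    and large: "2 * (real k * M) \<le> c * card Q"
  defines "f \<equiv> \<lambda>\<sigma>. - flat_form (\<lambda>i. x (\<sigma> i)) k k (s(k := 0)) 1 / flat_lead (\<lambda>i. x (\<sigma> i)) k"
  shows "\<exists>u v. c / 6 * real (card Q) ^ Suc k \<le>
      card {\<sigma> \<in> {..k} \<rightarrow>\<^sub>E Q. flat_lead (\<lambda>i. x (\<sigma> i)) k \<noteq> 0 \<and> u \<le> f \<sigma> \<and> f \<sigma> \<le> v} \<and>
    (\<forall>y. u \<le> y \<and> y \<le> v \<longrightarrow> c\<^sup>2 / 36 / (2 * real k + 2) ^ (k + 2) * real (card Q) ^ Suc (Suc k) \<le>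
      card {\<sigma> \<in> {..Suc k} \<rightarrow>\<^sub>E Q. simplex_meets_flat (Suc k) (\<lambda>i. x (\<sigma> i)) (s(k := y))})"
proof -
  define m where "m = real (card Q)"
  have m: "m > 0" using Q by (simp add: m_def card_gt_0_iff)
  define T where "T = {..k} \<rightarrow>\<^sub>E Q"
  define H where "H = {\<sigma> \<in> T. simplex_meets_flat k (\<lambda>i. x (\<sigma> i)) s}"
  define Dg where "Dg = {\<sigma> \<in> T. flat_lead (\<lambda>i. x (\<sigma> i)) k = 0}"
  define G where "G = H - Dg"
  have fT: "finite T" using Q by (auto simp: T_def intro!: finite_PiE)
  have fin: "finite H" "finite Dg" "finite G" using fT by (auto simp: H_def Dg_def G_def)
  have "card Dg \<le> k * M * card Q ^ k"
    unfolding Dg_def T_def using card_degenerate_tuples_le[OF Q(1) _ hyp] k by simp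
  then have "real (card Dg) \<le> real (k * M * card Q ^ k)" using of_nat_le_iff by blast
  also have "\<dots> = real k * M * m ^ k" by (simp add: m_def)
  also have "\<dots> \<le> c * m / 2 * m ^ k" using large m by (intro mult_right_mono) (auto simp: m_def)
  finally have Dg: "real (card Dg) \<le> c / 2 * m ^ Suc k" by simp
  have "card H \<le> card Dg + card G"
  proof -
    have "card H \<le> card (Dg \<union> G)" using fin by (intro card_mono) (auto simp: G_def)
    then show ?thesis using card_Un_le[of Dg G] by linarith
  qed
  then have G: "c / 2 * m ^ Suc k \<le> card G" using many Dg by (simp add: H_def T_def m_def)
  then have "real (card G) > 0" using c m
    by (meson half_gt_zero mult_pos_pos order_less_le_trans zero_less_power)
  then have Gne: "G \<noteq> {}" by auto
  obtain u v where uv: "card G \<le> 3 * card {\<sigma>\<in>G. f \<sigma> \<le> u}" "card G \<le> 3 * card {\<sigma>\<in>G. v \<le> f \<sigma>}"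
    "card G \<le> 3 * card {\<sigma>\<in>G. u \<le> f \<sigma> \<and> f \<sigma> \<le> v}"
    using middle_third_exists[OF fin(3) Gne] by blast
  have sixth: "c / 6 * m ^ Suc k \<le> card A" if "card G \<le> 3 * card B" "B \<subseteq> A" "finite A" for A B :: "(nat \<Rightarrow> 'a) set"
  proof -
    have "card G \<le> 3 * card A" using that card_mono[of A B] by linarith
    then have "real (card G) \<le> 3 * real (card A)" by linarith
    with G show ?thesis by linarith
  qed
  \<comment> \<open>For a nondegenerate simplex that meets the flat, \<open>f \<sigma>\<close> is
    the height of a meeting point.\<close>
  have pt: "\<exists>\<mu>. (\<forall>i\<le>k. 0 \<le> \<mu> i) \<and> (\<Sum>i\<le>k. \<mu> i) = 1 \<and> (\<forall>j<k. (\<Sum>i\<le>k. \<mu> i * x (\<sigma> i) j) = s j) \<and>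
      (\<Sum>i\<le>k. \<mu> i * x (\<sigma> i) k) = f \<sigma>" if sG: "\<sigma> \<in> G" for \<sigma>
  proof -
    obtain \<mu> where mu: "\<forall>i\<le>k. 0 \<le> \<mu> i" "(\<Sum>i\<le>k. \<mu> i) = 1" "\<forall>j<k. (\<Sum>i\<le>k. \<mu> i * x (\<sigma> i) j) = s j"
      using sG by (auto simp: G_def H_def simplex_meets_flat_def)
    have "flat_lead (\<lambda>i. x (\<sigma> i)) k \<noteq> 0" using sG by (auto simp: G_def Dg_def H_def)
    moreover have "flat_lead (\<lambda>i. x (\<sigma> i)) k * (\<Sum>i\<le>k. \<mu> i * x (\<sigma> i) k) =
        - flat_form (\<lambda>i. x (\<sigma> i)) k k (s(k := 0)) 1"
      using mu by (intro flat_lead_times_height) auto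
    ultimately have "(\<Sum>i\<le>k. \<mu> i * x (\<sigma> i) k) = f \<sigma>" by (simp add: f_def field_simps)
    with mu show ?thesis by blast
  qed
  show ?thesis
  proof (rule exI[of _ u], rule exI[of _ v], intro conjI allI impI; (elim conjE)?)
    show "c / 6 * real (card Q) ^ Suc k \<le>
        card {\<sigma> \<in> {..k} \<rightarrow>\<^sub>E Q. flat_lead (\<lambda>i. x (\<sigma> i)) k \<noteq> 0 \<and> u \<le> f \<sigma> \<and> f \<sigma> \<le> v}"
      unfolding m_def[symmetric]
    proof (rule sixth[OF uv(3)])
      show "finite {\<sigma> \<in> {..k} \<rightarrow>\<^sub>E Q. flat_lead (\<lambda>i. x (\<sigma> i)) k \<noteq> 0 \<and> u \<le> f \<sigma> \<and> f \<sigma> \<le> v}"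
        using fT by (simp add: T_def)
    qed (auto simp: G_def H_def Dg_def T_def)
    fix y assume y: "u \<le> y" "y \<le> v"
    define L where "L = {\<sigma>\<in>G. f \<sigma> \<le> y}"
    define U where "U = {\<sigma>\<in>G. y \<le> f \<sigma>}"
    define N where "N = card {\<sigma> \<in> {..Suc k} \<rightarrow>\<^sub>E Q. simplex_meets_flat (Suc k) (\<lambda>i. x (\<sigma> i)) (s(k := y))}"
    have L: "c / 6 * m ^ Suc k \<le> card L"
      by (rule sixth[OF uv(1)]) (use y fin in \<open>auto simp: L_def\<close>)
    have U: "c / 6 * m ^ Suc k \<le> card U"
      by (rule sixth[OF uv(2)]) (use y fin in \<open>auto simp: U_def\<close>)
    have "card L * card U \<le> (2 * k + 2) ^ (k + 2) * (N * card Q ^ k)"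
      unfolding N_def
    proof (rule card_simplices_meeting_next_flat_ge[OF Q(1)])
      show "L \<subseteq> {..k} \<rightarrow>\<^sub>E Q" "U \<subseteq> {..k} \<rightarrow>\<^sub>E Q" by (auto simp: L_def U_def G_def H_def T_def)
      show "\<exists>\<mu>. (\<forall>i\<le>k. 0 \<le> \<mu> i) \<and> sum \<mu> {..k} = 1 \<and>
        (\<forall>j<k. (\<Sum>i\<le>k. \<mu> i * x (\<sigma> i) j) = (s(k := y)) j) \<and> (\<Sum>i\<le>k. \<mu> i * x (\<sigma> i) k) \<le> (s(k := y)) k"
        if "\<sigma> \<in> L" for \<sigma> using pt[of \<sigma>] that by (auto simp: L_def)
      show "\<exists>\<mu>. (\<forall>i\<le>k. 0 \<le> \<mu> i) \<and> sum \<mu> {..k} = 1 \<and>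
        (\<forall>j<k. (\<Sum>i\<le>k. \<mu> i * x (\<sigma> i) j) = (s(k := y)) j) \<and> (s(k := y)) k \<le> (\<Sum>i\<le>k. \<mu> i * x (\<sigma> i) k)"
        if "\<sigma> \<in> U" for \<sigma> using pt[of \<sigma>] that by (auto simp: U_def)
    qed
    then have "real (card L * card U) \<le> real ((2 * k + 2) ^ (k + 2) * (N * card Q ^ k))"
      using of_nat_le_iff by blast
    then have "real (card L) * card U \<le> (2 * real k + 2) ^ (k + 2) * (N * m ^ k)"
      by (simp only: m_def of_nat_mult of_nat_power of_nat_add of_nat_numeral)
    moreover define B where "B = (2 * real k + 2) ^ (k + 2)"
    ultimately have 1: "real (card L) * card U \<le> B * (N * m ^ k)" by simp
    have "(c / 6 * m ^ Suc k) * (c / 6 * m ^ Suc k) \<le> real (card L) * card U"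
      using L U c m by (intro mult_mono) auto
    with 1 have "(c\<^sup>2 / 36 * m ^ Suc (Suc k)) * m ^ k \<le> (B * N) * m ^ k"
      by (simp add: power2_eq_square algebra_simps)
    then have "c\<^sup>2 / 36 * m ^ Suc (Suc k) \<le> B * N"
      using m by (simp only: mult_le_cancel_right_pos zero_less_power)
    moreover have "B > 0" by (simp add: B_def)
    ultimately have "c\<^sup>2 / 36 * m ^ Suc (Suc k) / B \<le> N"
      by (simp only: pos_divide_le_eq mult.commute)
    then show "c\<^sup>2 / 36 / (2 * real k + 2) ^ (k + 2) * real (card Q) ^ Suc (Suc k) \<le> real N"
      unfolding B_def[symmetric] by (simp add: m_def)
  qed
qed

section \<open>The next coordinate as a rational function of time\<close>

text \<open>The equation of \<open>flat_form\<close> solved for coordinate \<open>k\<close>, at the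
  point with coordinates \<open>a i / b i\<close>, scaled by the common denominator: the coordinates
  become \<open>a i\<close> times the other \<open>b l\<close>, and the homogenising variable
  becomes the product of all \<open>b l\<close>.\<close>

definition flat_numer :: "nat \<Rightarrow> (nat \<Rightarrow> real poly) \<Rightarrow> (nat \<Rightarrow> real poly) \<Rightarrow> (nat \<Rightarrow> nat \<Rightarrow> real poly) \<Rightarrow> real poly" where
  "flat_numer k a b z =
     - flat_form z k k (\<lambda>i. if i < k then a i * (\<Prod>l\<in>{..<k} - {i}. b l) else 0) (\<Prod>l<k. b l)"

definition flat_denom :: "nat \<Rightarrow> (nat \<Rightarrow> real poly) \<Rightarrow> (nat \<Rightarrow> nat \<Rightarrow> real poly) \<Rightarrow> real poly" where
  "flat_denom k b z = flat_lead z k * (\<Prod>l<k. b l)"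

lemma poly_flat_denom_eq_0_iff:
  assumes "\<And>i. i < k \<Longrightarrow> poly (b i) t \<noteq> 0"
  shows "poly (flat_denom k b z) t = 0 \<longleftrightarrow> flat_lead (\<lambda>i j. poly (z i j) t) k = 0"
  using assms by (auto simp: flat_denom_def poly_flat_lead poly_prod)

lemma poly_flat_numer_divide_denom:
  assumes b: "\<And>i. i < k \<Longrightarrow> poly (b i) t \<noteq> 0"
  shows "poly (flat_numer k a b z) t / poly (flat_denom k b z) t =
    - flat_form (\<lambda>i j. poly (z i j) t) k k ((\<lambda>i. poly (a i) t / poly (b i) t)(k := 0)) 1 /
      flat_lead (\<lambda>i j. poly (z i j) t) k"
proof -
  define s where "s = (\<lambda>i. poly (a i) t / poly (b i) t)"
  define W where "W = (\<Prod>l<k. poly (b l) t)"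
  have W: "W \<noteq> 0" using b by (simp add: W_def)
  have "poly (a i) t * (\<Prod>l\<in>{..<k} - {i}. poly (b l) t) = W * s i" if "i < k" for i
    using that b[OF that] prod.remove[of "{..<k}" i "\<lambda>l. poly (b l) t"] by (simp add: W_def s_def)
  then have "flat_form (\<lambda>i j. poly (z i j) t) k k
      (\<lambda>j. poly (if j < k then a j * (\<Prod>l\<in>{..<k} - {j}. b l) else 0) t) W =
    flat_form (\<lambda>i j. poly (z i j) t) k k (\<lambda>j. W * (s(k := 0)) j) (W * 1)"
    unfolding mult_1_right by (intro flat_form_cong_point) (auto simp: poly_prod)
  also have "\<dots> = W * flat_form (\<lambda>i j. poly (z i j) t) k k (s(k := 0)) 1"
    by (rule flat_form_scale)
  finally have "poly (flat_numer k a b z) t = - (W * flat_form (\<lambda>i j. poly (z i j) t) k k (s(k := 0)) 1)"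
    by (simp add: flat_numer_def poly_flat_form poly_prod W_def)
  then show ?thesis using W by (simp add: flat_denom_def poly_flat_lead poly_prod W_def[symmetric] s_def)
qed

text \<open>All arguments of the elimination have degree at most
  \<open>k * \<gamma> + \<beta>\<close>, which it multiplies by \<open>2 ^ (k + 1)\<close>. The
  extra factor 2 covers the product of the \<open>b l\<close> in the denominator.\<close>

lemma degree_flat_numer_denom_le:
  assumes ab: "\<And>i. i < k \<Longrightarrow> degree (a i) \<le> \<gamma> \<and> degree (b i) \<le> \<gamma>"
    and z: "\<And>i j. i \<le> k \<Longrightarrow> degree (z i j) \<le> \<beta>"
  shows "degree (flat_numer k a b z) \<le> 2 ^ (k + 2) * (k * \<gamma> + \<beta>)"
    and "degree (flat_denom k b z) \<le> 2 ^ (k + 2) * (k * \<gamma> + \<beta>)"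
proof -
  have prod: "degree (\<Prod>l\<in>A. b l) \<le> card A * \<gamma>" if "A \<subseteq> {..<k}" for A
  proof -
    have "degree (\<Prod>l\<in>A. b l) \<le> (\<Sum>l\<in>A. degree (b l))"
      using degree_prod_sum_le[of A b] finite_subset[OF that] by (simp add: comp_def)
    also have "\<dots> \<le> (\<Sum>l\<in>A. \<gamma>)" using that ab by (intro sum_mono) auto
    finally show ?thesis by simp
  qed
  have w: "degree (\<Prod>l<k. b l) \<le> k * \<gamma> + \<beta>" using prod[of "{..<k}"] by simp
  have y: "degree (if i < k then a i * (\<Prod>l\<in>{..<k} - {i}. b l) else 0) \<le> k * \<gamma> + \<beta>" for i
  proof (cases "i < k")
    case True
    have "degree (a i * (\<Prod>l\<in>{..<k} - {i}. b l)) \<le> degree (a i) + degree (\<Prod>l\<in>{..<k} - {i}. b l)"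
      by (rule degree_mult_le)
    also have "\<dots> \<le> \<gamma> + (k - 1) * \<gamma>" using ab[OF True] prod[of "{..<k} - {i}"] True by (intro add_mono) auto
    also have "\<dots> = k * \<gamma>" using True by (cases k) auto
    finally show ?thesis using True by simp
  qed simp
  have zd: "degree (z i j) \<le> k * \<gamma> + \<beta>" if "i \<le> k" for i j using z[OF that, of j] by simp
  have "degree (flat_numer k a b z) \<le> 2 ^ Suc k * (k * \<gamma> + \<beta>)"
    unfolding flat_numer_def degree_minus using zd y w by (rule degree_flat_form_le)
  then show "degree (flat_numer k a b z) \<le> 2 ^ (k + 2) * (k * \<gamma> + \<beta>)" by simp
  have "degree (flat_denom k b z) \<le> degree (flat_lead z k) + degree (\<Prod>l<k. b l)"
    unfolding flat_denom_def by (rule degree_mult_le)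
  also have "\<dots> \<le> 2 ^ Suc k * (k * \<gamma> + \<beta>) + 2 ^ Suc k * (k * \<gamma> + \<beta>)"
  proof (rule add_mono)
    show "degree (flat_lead z k) \<le> 2 ^ Suc k * (k * \<gamma> + \<beta>)" using zd by (rule degree_flat_lead_le)
    have "1 * (k * \<gamma> + \<beta>) \<le> 2 ^ Suc k * (k * \<gamma> + \<beta>)" by (rule mult_le_mono1) simp
    then show "degree (\<Prod>l<k. b l) \<le> 2 ^ Suc k * (k * \<gamma> + \<beta>)" using w by (simp only: mult_1 order_trans)
  qed
  finally show "degree (flat_denom k b z) \<le> 2 ^ (k + 2) * (k * \<gamma> + \<beta>)" by (simp add: ac_simps)
qed

section \<open>The invariant and its induction\<close>

text \<open>The consequence of general position used for counting degenerate tuples. It counts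
  moving points, not positions, so coinciding points count separately.\<close>

definition generic_at :: "nat \<Rightarrow> ('p \<Rightarrow> nat \<Rightarrow> real poly) \<Rightarrow> 'p set \<Rightarrow> real \<Rightarrow> bool" where
  "generic_at d x Q t \<longleftrightarrow>
     (\<forall>h c. (\<exists>j<d. h j \<noteq> 0) \<longrightarrow> card {q\<in>Q. (\<Sum>j<d. h j * poly (x q j) t) = c} \<le> d + 1)"

text \<open>
  An element \<open>(a, b)\<close> of \<open>F\<close> stands for the moving flat on which coordinate \<open>i < k\<close> has the value \<open>a i / b i\<close>.
\<close>

definition kinetic_flats :: "nat \<Rightarrow> nat \<Rightarrow> nat \<Rightarrow> real \<Rightarrow> nat \<Rightarrow> real \<Rightarrow> 'p set \<Rightarrow> ('p \<Rightarrow> nat \<Rightarrow> real poly) \<Rightarrow>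
    ((nat \<Rightarrow> real poly) \<times> (nat \<Rightarrow> real poly)) set \<Rightarrow> bool" where
  "kinetic_flats d k \<gamma> c m r P x F \<longleftrightarrow> finite F \<and>
     (\<forall>(a, b)\<in>F. (\<forall>i<k. b i \<noteq> 0 \<and> degree (a i) \<le> \<gamma> \<and> degree (b i) \<le> \<gamma>) \<and> (0 < k \<longrightarrow> b 0 = 1)) \<and>
     (\<forall>t. \<forall>Q\<subseteq>P. generic_at d x Q t \<and> card P / r < card Q \<and> m \<le> card Q \<longrightarrow>
       (\<exists>(a, b)\<in>F. (\<forall>i<k. poly (b i) t \<noteq> 0) \<and>
         c * real (card Q) ^ Suc k \<le> card {\<sigma> \<in> {..k} \<rightarrow>\<^sub>E Q.
           simplex_meets_flat k (\<lambda>i j. poly (x (\<sigma> i) j) t) (\<lambda>i. poly (a i) t / poly (b i) t)}))"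

lemma kinetic_flats_0:
  "kinetic_flats d 0 0 1 0 r P x {(\<lambda>_. 0, \<lambda>_. 1)}"
proof -
  have "simplex_meets_flat 0 z s" for z s
    unfolding simplex_meets_flat_def by (rule exI[of _ "\<lambda>_. 1"]) simp
  then show ?thesis by (simp add: kinetic_flats_def card_PiE)
qed

text \<open>Each flat of \<open>F\<close> is extended by the coordinates that a net selects among
  those of the tuples in \<open>P\<close>. The bound \<open>m1\<close> makes degenerate tuples at
  most half of the relevant ones.\<close>

lemma kinetic_flats_step:
  fixes \<beta> \<gamma> d k m0 :: nat and c :: real
  assumes k: "k < d" and c: "0 < c" "c \<le> 1"
  defines "\<gamma>' \<equiv> \<gamma> + 2 ^ (k + 2) * (k * \<gamma> + \<beta>)"
    and "c' \<equiv> c\<^sup>2 / 36 / (2 * real k + 2) ^ (k + 2)"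
    and "m1 \<equiv> max m0 (nat \<lceil>2 * (real k * (d + 1)) / c\<rceil>)"
  shows "\<exists>K\<ge>0. \<forall>(P :: 'p set) x r F. finite P \<and> (\<forall>p\<in>P. \<forall>j. degree (x p j) \<le> \<beta>) \<and> r \<ge> 2 \<and>
      kinetic_flats d k \<gamma> c m0 r P x F \<longrightarrow>
    (\<exists>F'. kinetic_flats d (Suc k) \<gamma>' c' m1 r P x F' \<and> real (card F') \<le> card F * (K * r ^ Suc k * ln r))"
proof -
  obtain K where K: "K > 0" "\<And>(X :: (nat \<Rightarrow> 'p) set) a b (q::real). finite X \<Longrightarrow> q \<ge> 2 \<Longrightarrow>
      (\<forall>x\<in>X. degree (a x) \<le> \<gamma>' \<and> degree (b x) \<le> \<gamma>') \<Longrightarrow>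
    (\<exists>S\<subseteq>X. real (card S) \<le> K * q * ln q \<and>
      (\<forall>t u v. real (card (kinetic_interval X a b t u v)) > card X / q \<longrightarrow>
        S \<inter> kinetic_interval X a b t u v \<noteq> {}))"
    using kinetic_interval_net[of \<gamma>', where 'a = "nat \<Rightarrow> 'p"] by auto
  \<comment> \<open>As \<open>r \<ge> 2\<close>, the constant \<open>ln (6 / c)\<close> in
    \<open>ln q\<close> is absorbed as \<open>ln (6 / c) / ln 2 * ln r\<close>.\<close>
  define K' where "K' = K * (6 / c) * (ln (6 / c) / ln 2 + Suc k)"
  have ln6: "ln (6 / c) \<ge> 0" using c by simp
  show ?thesis
  proof (intro exI[of _ K'] conjI allI impI; (elim conjE)?)
    show "K' \<ge> 0" using K(1) c ln6 by (simp add: K'_def)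
    fix P :: "'p set" and x :: "'p \<Rightarrow> nat \<Rightarrow> real poly" and r :: real and F
    assume P: "finite P" and degx: "\<forall>p\<in>P. \<forall>j. degree (x p j) \<le> \<beta>" and r: "r \<ge> 2"
      and F: "kinetic_flats d k \<gamma> c m0 r P x F"
    \<comment> \<open>Chosen so that \<open>card X / q\<close> equals
      \<open>c / 6 * (card P / r) ^ Suc k\<close>, which is less than the number of tuples of
      \<open>Q\<close> in the middle interval.\<close>
    define q where "q = 6 / c * r ^ Suc k"
    have q6: "6 / c \<ge> 6" using c by (simp add: field_simps)
    have r1: "r ^ Suc k \<ge> 1" using r by (intro one_le_power) simp
    have q: "q \<ge> 2" using mult_mono[OF q6 r1] q6 r1 c by (simp add: q_def)
    have lnr: "ln r \<ge> ln 2" "ln r > 0" using r by simp_all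
    have "ln q = ln (6 / c) + ln (r ^ Suc k)" unfolding q_def by (rule ln_mult_pos) (use c r in auto)
    also have "ln (r ^ Suc k) = Suc k * ln r" by (rule ln_realpow)
    also have "ln (6 / c) \<le> ln (6 / c) / ln 2 * ln r"
      using mult_left_mono[OF lnr(1) ln6] by (simp add: field_simps)
    finally have lnq: "ln q \<le> (ln (6 / c) / ln 2 + Suc k) * ln r" by (simp add: algebra_simps)
    have size: "K * q * ln q \<le> K' * r ^ Suc k * ln r"
    proof -
      have "K * q * ln q \<le> K * q * ((ln (6 / c) / ln 2 + Suc k) * ln r)"
        using lnq K(1) q by (intro mult_left_mono) auto
      also have "\<dots> = K' * r ^ Suc k * ln r" by (simp only: K'_def q_def mult_ac)
      finally show ?thesis .
    qed
    \<comment> \<open>The net is taken over tuples of all of \<open>P\<close>, since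
      \<open>Q\<close> varies with time and with the convex set.\<close>
    define X where "X = {..k} \<rightarrow>\<^sub>E P"
    have fX: "finite X" and cX: "card X = card P ^ Suc k"
      using P by (auto simp: X_def card_PiE intro!: finite_PiE)
    define num where "num = (\<lambda>a b \<sigma>. flat_numer k a b (\<lambda>i. x (\<sigma> i)))"
    define den where "den = (\<lambda>b \<sigma>. flat_denom k b (\<lambda>i. x (\<sigma> i)))"
    have fF: "finite F" and Fab: "\<And>a b. (a, b) \<in> F \<Longrightarrow>
        (\<forall>i<k. b i \<noteq> 0 \<and> degree (a i) \<le> \<gamma> \<and> degree (b i) \<le> \<gamma>) \<and> (0 < k \<longrightarrow> b 0 = 1)"
      and FQ: "\<And>t Q. Q \<subseteq> P \<Longrightarrow> generic_at d x Q t \<Longrightarrow> card P / r < card Q \<Longrightarrow> m0 \<le> card Q \<Longrightarrow>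
       (\<exists>(a, b)\<in>F. (\<forall>i<k. poly (b i) t \<noteq> 0) \<and>
         c * real (card Q) ^ Suc k \<le> card {\<sigma> \<in> {..k} \<rightarrow>\<^sub>E Q.
           simplex_meets_flat k (\<lambda>i j. poly (x (\<sigma> i) j) t) (\<lambda>i. poly (a i) t / poly (b i) t)})"
      using F unfolding kinetic_flats_def by blast+
    have deg: "degree (num a b \<sigma>) \<le> \<gamma>' \<and> degree (den b \<sigma>) \<le> \<gamma>'" if ab: "(a, b) \<in> F" and s: "\<sigma> \<in> X" for a b \<sigma>
    proof -
      have "degree (x (\<sigma> i) j) \<le> \<beta>" if "i \<le> k" for i j
        using s that degx by (auto simp: X_def)
      then show ?thesis
        using degree_flat_numer_denom_le[of k a \<gamma> b "\<lambda>i. x (\<sigma> i)" \<beta>] Fab[OF ab]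
        by (simp add: num_def den_def \<gamma>'_def)
    qed
    have "\<exists>S\<subseteq>X. real (card S) \<le> K * q * ln q \<and>
      (\<forall>t u v. real (card (kinetic_interval X (num a b) (den b) t u v)) > card X / q \<longrightarrow>
        S \<inter> kinetic_interval X (num a b) (den b) t u v \<noteq> {})" if "(a, b) \<in> F" for a b
      using K(2)[OF fX q] deg[OF that] by blast
    then have "\<forall>ab\<in>F. \<exists>S. S \<subseteq> X \<and> real (card S) \<le> K * q * ln q \<and>
      (\<forall>t u v. real (card (kinetic_interval X (num (fst ab) (snd ab)) (den (snd ab)) t u v)) > card X / q \<longrightarrow>
        S \<inter> kinetic_interval X (num (fst ab) (snd ab)) (den (snd ab)) t u v \<noteq> {})" by fastforce
    then obtain S where S: "\<And>ab. ab \<in> F \<Longrightarrow> S ab \<subseteq> X \<and> real (card (S ab)) \<le> K * q * ln q \<and>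
      (\<forall>t u v. real (card (kinetic_interval X (num (fst ab) (snd ab)) (den (snd ab)) t u v)) > card X / q \<longrightarrow>
        S ab \<inter> kinetic_interval X (num (fst ab) (snd ab)) (den (snd ab)) t u v \<noteq> {})"
      by (metis (lifting) bchoice)
    define ext where "ext = (\<lambda>(ab, \<sigma>). ((fst ab)(k := num (fst ab) (snd ab) \<sigma>), (snd ab)(k := den (snd ab) \<sigma>)))"
    \<comment> \<open>Tuples with identically zero denominator are dropped; a tuple by which the net
      hits an interval has a nonzero one.\<close>
    define F' where "F' = ext ` (SIGMA ab:F. {\<sigma>\<in>S ab. den (snd ab) \<sigma> \<noteq> 0})"
    have fS: "finite (S ab)" if "ab \<in> F" for ab using S[OF that] fX finite_subset by blast
    have fin: "finite (SIGMA ab:F. {\<sigma>\<in>S ab. den (snd ab) \<sigma> \<noteq> 0})" using fF fS by auto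
    have "real (card F') \<le> card (SIGMA ab:F. {\<sigma>\<in>S ab. den (snd ab) \<sigma> \<noteq> 0})"
      unfolding F'_def using card_image_le[OF fin] by simp
    also have "\<dots> = (\<Sum>ab\<in>F. real (card {\<sigma>\<in>S ab. den (snd ab) \<sigma> \<noteq> 0}))"
      using fF fS by (subst card_SigmaI) auto
    also have "\<dots> \<le> (\<Sum>ab\<in>F. K * q * ln q)"
    proof (rule sum_mono)
      fix ab assume ab: "ab \<in> F"
      have "card {\<sigma>\<in>S ab. den (snd ab) \<sigma> \<noteq> 0} \<le> card (S ab)" using fS[OF ab] by (intro card_mono) auto
      then show "real (card {\<sigma>\<in>S ab. den (snd ab) \<sigma> \<noteq> 0}) \<le> K * q * ln q" using S[OF ab] by linarith
    qed
    also have "\<dots> = card F * (K * q * ln q)" by simp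
    also have "\<dots> \<le> card F * (K' * r ^ Suc k * ln r)" using size by (intro mult_left_mono) auto
    finally have card: "real (card F') \<le> card F * (K' * r ^ Suc k * ln r)" .
    have F'ab: "(\<forall>i<Suc k. b' i \<noteq> 0 \<and> degree (a' i) \<le> \<gamma>' \<and> degree (b' i) \<le> \<gamma>') \<and> b' 0 = 1"
      if "(a', b') \<in> F'" for a' b'
    proof -
      obtain a b \<sigma> where ab: "(a, b) \<in> F" "\<sigma> \<in> S (a, b)" "den b \<sigma> \<noteq> 0"
        "a' = a(k := num a b \<sigma>)" "b' = b(k := den b \<sigma>)"
        using \<open>(a', b') \<in> F'\<close> by (auto simp: F'_def ext_def)
      have sX: "\<sigma> \<in> X" using S[OF ab(1)] ab(2) by blast
      have "\<gamma> \<le> \<gamma>'" by (simp add: \<gamma>'_def)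
      then have "\<forall>i<Suc k. b' i \<noteq> 0 \<and> degree (a' i) \<le> \<gamma>' \<and> degree (b' i) \<le> \<gamma>'"
        using Fab[OF ab(1)] deg[OF ab(1) sX] ab(3) by (fastforce simp: ab(4,5) less_Suc_eq)
      \<comment> \<open>The first coordinate has lead 1 and an empty product as denominator, which
        is why it is a polynomial in the end.\<close>
      moreover have "b' 0 = 1"
        using Fab[OF ab(1)] by (cases "k = 0") (auto simp: ab(5) den_def flat_denom_def)
      ultimately show ?thesis by blast
    qed
    have F'Q: "\<exists>(a, b)\<in>F'. (\<forall>i<Suc k. poly (b i) t \<noteq> 0) \<and>
         c' * real (card Q) ^ Suc (Suc k) \<le> card {\<sigma> \<in> {..Suc k} \<rightarrow>\<^sub>E Q.
           simplex_meets_flat (Suc k) (\<lambda>i j. poly (x (\<sigma> i) j) t) (\<lambda>i. poly (a i) t / poly (b i) t)}"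
      if Q: "Q \<subseteq> P" "generic_at d x Q t" "card P / r < card Q" "m1 \<le> card Q" for t Q
    proof -
      have fQ: "finite Q" using Q(1) P by (rule finite_subset)
      have "card P / r \<ge> 0" using r by simp
      with Q(3) have cQ: "real (card Q) > 0" by linarith
      then have Qne: "Q \<noteq> {}" by auto
      obtain a b where ab: "(a, b) \<in> F" "\<forall>i<k. poly (b i) t \<noteq> 0"
        "c * real (card Q) ^ Suc k \<le> card {\<sigma> \<in> {..k} \<rightarrow>\<^sub>E Q.
           simplex_meets_flat k (\<lambda>i j. poly (x (\<sigma> i) j) t) (\<lambda>i. poly (a i) t / poly (b i) t)}"
        using FQ[OF Q(1-3)] Q(4) by (auto simp: m1_def)
      define s where "s = (\<lambda>i. poly (a i) t / poly (b i) t)"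
      define xt where "xt = (\<lambda>p j. poly (x p j) t)"
      define f where "f = (\<lambda>\<sigma>. - flat_form (\<lambda>i. xt (\<sigma> i)) k k (s(k := 0)) 1 / flat_lead (\<lambda>i. xt (\<sigma> i)) k)"
      have f: "poly (num a b \<sigma>) t / poly (den b \<sigma>) t = f \<sigma>" for \<sigma>
        using poly_flat_numer_divide_denom[of k b t a "\<lambda>i. x (\<sigma> i)"] ab(2)
        by (simp add: num_def den_def f_def s_def xt_def)
      have den0: "poly (den b \<sigma>) t = 0 \<longleftrightarrow> flat_lead (\<lambda>i. xt (\<sigma> i)) k = 0" for \<sigma>
        using poly_flat_denom_eq_0_iff[of k b t "\<lambda>i. x (\<sigma> i)"] ab(2) by (simp add: den_def xt_def)
      have "2 * (real k * (d + 1)) / c \<le> card Q" using Q(4) unfolding m1_def by linarith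
      then have large: "2 * (real k * real (d + 1)) \<le> c * card Q" using c by (simp add: field_simps)
      obtain u v where uv: "c / 6 * real (card Q) ^ Suc k \<le>
          card {\<sigma> \<in> {..k} \<rightarrow>\<^sub>E Q. flat_lead (\<lambda>i. xt (\<sigma> i)) k \<noteq> 0 \<and> u \<le> f \<sigma> \<and> f \<sigma> \<le> v}"
        "\<And>y. u \<le> y \<Longrightarrow> y \<le> v \<Longrightarrow> c' * real (card Q) ^ Suc (Suc k) \<le>
          card {\<sigma> \<in> {..Suc k} \<rightarrow>\<^sub>E Q. simplex_meets_flat (Suc k) (\<lambda>i. xt (\<sigma> i)) (s(k := y))}"
        using middle_interval_exists[OF fQ Qne k c(1), of xt "d + 1" s] Q(2) ab(3) large
        unfolding generic_at_def f_def c'_def xt_def s_def by blast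
      let ?R = "kinetic_interval X (num a b) (den b) t u v"
      have sub: "{\<sigma> \<in> {..k} \<rightarrow>\<^sub>E Q. flat_lead (\<lambda>i. xt (\<sigma> i)) k \<noteq> 0 \<and> u \<le> f \<sigma> \<and> f \<sigma> \<le> v} \<subseteq> ?R"
        using PiE_mono[of "{..k}" "\<lambda>_. Q" "\<lambda>_. P"] Q(1) unfolding kinetic_interval_def f den0 X_def by blast
      have "finite ?R" using fX by (simp add: kinetic_interval_def)
      with sub have "real (card {\<sigma> \<in> {..k} \<rightarrow>\<^sub>E Q. flat_lead (\<lambda>i. xt (\<sigma> i)) k \<noteq> 0 \<and> u \<le> f \<sigma> \<and> f \<sigma> \<le> v}) \<le> card ?R"
        by (simp add: card_mono)
      with uv(1) have R: "c / 6 * real (card Q) ^ Suc k \<le> card ?R" by linarith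
      have "real (card X) / q = c / 6 * (card P / r) ^ Suc k"
        by (simp add: cX q_def power_divide)
      also have "\<dots> < c / 6 * real (card Q) ^ Suc k"
        using Q(3) c r by (intro mult_strict_left_mono power_strict_mono) auto
      also note R
      finally have "S (a, b) \<inter> ?R \<noteq> {}" using S[OF ab(1)] by simp
      then obtain \<sigma> where s: "\<sigma> \<in> S (a, b)" "poly (den b \<sigma>) t \<noteq> 0" "u \<le> f \<sigma>" "f \<sigma> \<le> v"
        by (auto simp: kinetic_interval_def f)
      define a' where "a' = a(k := num a b \<sigma>)"
      define b' where "b' = b(k := den b \<sigma>)"
      have "(a', b') \<in> F'"
        using s ab(1) unfolding F'_def ext_def a'_def b'_def
        by (intro image_eqI[of _ _ "((a, b), \<sigma>)"]) auto
      moreover have "\<forall>i<Suc k. poly (b' i) t \<noteq> 0" using ab(2) s(2) by (simp add: b'_def less_Suc_eq)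
      moreover have "(\<lambda>i. poly (a' i) t / poly (b' i) t) = s(k := f \<sigma>)"
        by (auto simp: a'_def b'_def s_def fun_eq_iff f)
      then have "c' * real (card Q) ^ Suc (Suc k) \<le> card {\<sigma> \<in> {..Suc k} \<rightarrow>\<^sub>E Q.
           simplex_meets_flat (Suc k) (\<lambda>i j. poly (x (\<sigma> i) j) t) (\<lambda>i. poly (a' i) t / poly (b' i) t)}"
        using uv(2)[OF s(3,4)] by (simp only: xt_def)
      ultimately show ?thesis by blast
    qed
    have "kinetic_flats d (Suc k) \<gamma>' c' m1 r P x F'"
      unfolding kinetic_flats_def
    proof (intro conjI allI impI; (elim conjE)?)
      show "finite F'" using fin by (simp add: F'_def)
      show "\<forall>(a, b)\<in>F'. (\<forall>i<Suc k. b i \<noteq> 0 \<and> degree (a i) \<le> \<gamma>' \<and> degree (b i) \<le> \<gamma>') \<and> (0 < Suc k \<longrightarrow> b 0 = 1)"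
        using F'ab by blast
    qed (use F'Q in blast)
    with card show "\<exists>F'. kinetic_flats d (Suc k) \<gamma>' c' m1 r P x F' \<and> real (card F') \<le> card F * (K' * r ^ Suc k * ln r)"
      by blast
  qed
qed

text \<open>Step \<open>k\<close> contributes \<open>r ^ Suc k * ln r\<close>, and
  \<open>1 + ... + k = k * (k + 1) div 2\<close>.\<close>

lemma kinetic_flats_exist:
  fixes \<beta> d k :: nat
  assumes "k \<le> d"
  shows "\<exists>C \<gamma> c m. 0 \<le> C \<and> 0 < c \<and> c \<le> 1 \<and> (\<forall>(P :: 'p set) x r. finite P \<and>
      (\<forall>p\<in>P. \<forall>j. degree (x p j) \<le> \<beta>) \<and> r \<ge> 2 \<longrightarrow>
    (\<exists>F. kinetic_flats d k \<gamma> c m r P x F \<and> real (card F) \<le> C * r ^ (k * (k + 1) div 2) * ln r ^ k))"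
  using assms
proof (induction k)
  case 0
  show ?case
  proof (rule exI[of _ 1], rule exI[of _ 0], rule exI[of _ 1], rule exI[of _ 0], intro conjI allI impI)
    fix P :: "'p set" and x :: "'p \<Rightarrow> nat \<Rightarrow> real poly" and r :: real
    show "\<exists>F. kinetic_flats d 0 0 1 0 r P x F \<and> real (card F) \<le> 1 * r ^ (0 * (0 + 1) div 2) * ln r ^ 0"
      using kinetic_flats_0[of d r P x] by (intro exI[of _ "{(\<lambda>_. 0, \<lambda>_. 1)}"]) simp
  qed auto
next
  case (Suc k)
  obtain C \<gamma> c m where IH: "0 \<le> C" "0 < c" "c \<le> 1" "\<forall>(P :: 'p set) x r. finite P \<and>
      (\<forall>p\<in>P. \<forall>j. degree (x p j) \<le> \<beta>) \<and> r \<ge> 2 \<longrightarrow>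
    (\<exists>F. kinetic_flats d k \<gamma> c m r P x F \<and> real (card F) \<le> C * r ^ (k * (k + 1) div 2) * ln r ^ k)"
    using Suc.IH[OF Suc_leD[OF Suc.prems]] by (elim exE conjE) (rule that)
  define \<gamma>' where "\<gamma>' = \<gamma> + 2 ^ (k + 2) * (k * \<gamma> + \<beta>)"
  define c' where "c' = c\<^sup>2 / 36 / (2 * real k + 2) ^ (k + 2)"
  define m1 where "m1 = max m (nat \<lceil>2 * (real k * (d + 1)) / c\<rceil>)"
  have "k < d" using Suc.prems by simp
  from kinetic_flats_step[OF this IH(2,3), of \<beta> \<gamma> m, where 'p = 'p]
  obtain K where K: "K \<ge> 0" "\<forall>(P :: 'p set) x r F. finite P \<and> (\<forall>p\<in>P. \<forall>j. degree (x p j) \<le> \<beta>) \<and> r \<ge> 2 \<and>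
      kinetic_flats d k \<gamma> c m r P x F \<longrightarrow>
    (\<exists>F'. kinetic_flats d (Suc k) \<gamma>' c' m1 r P x F' \<and> real (card F') \<le> card F * (K * r ^ Suc k * ln r))"
    unfolding \<gamma>'_def[symmetric] c'_def[symmetric] m1_def[symmetric] by (elim exE conjE) (rule that)
  have c'0: "0 < c'" using IH(2) by (simp add: c'_def)
  have "c\<^sup>2 \<le> 1" using IH(2,3) by (simp add: power_le_one)
  moreover have "(1::real) \<le> (2 * real k + 2) ^ (k + 2)" by (intro one_le_power) simp
  ultimately have c'1: "c' \<le> 1"
    unfolding c'_def by (smt (verit) divide_le_eq_1 IH(2) zero_less_power)
  show ?case
  proof (rule exI[of _ "C * K"], rule exI[of _ \<gamma>'], rule exI[of _ c'], rule exI[of _ m1],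
      intro conjI allI impI; (elim conjE)?)
    fix P :: "'p set" and x :: "'p \<Rightarrow> nat \<Rightarrow> real poly" and r :: real
    assume P: "finite P" "\<forall>p\<in>P. \<forall>j. degree (x p j) \<le> \<beta>" and r: "2 \<le> r"
    obtain F where F: "kinetic_flats d k \<gamma> c m r P x F" "real (card F) \<le> C * r ^ (k * (k + 1) div 2) * ln r ^ k"
      using IH(4)[rule_format, of P x r] P r by blast
    obtain F' where F': "kinetic_flats d (Suc k) \<gamma>' c' m1 r P x F'" "real (card F') \<le> card F * (K * r ^ Suc k * ln r)"
      using K(2)[rule_format, of P x r F] P r F(1) by blast
    have "Suc k * (Suc k + 1) = k * (k + 1) + 2 * Suc k" by simp
    then have ex: "Suc k * (Suc k + 1) div 2 = k * (k + 1) div 2 + Suc k" by simp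
    have "K * r ^ Suc k * ln r \<ge> 0" using K(1) r by simp
    then have "real (card F') \<le> (C * r ^ (k * (k + 1) div 2) * ln r ^ k) * (K * r ^ Suc k * ln r)"
      using F'(2) mult_right_mono[OF F(2)] by force
    also have "\<dots> = C * K * r ^ (Suc k * (Suc k + 1) div 2) * ln r ^ Suc k"
      unfolding ex power_add by simp
    finally show "\<exists>F. kinetic_flats d (Suc k) \<gamma>' c' m1 r P x F \<and>
        real (card F) \<le> C * K * r ^ (Suc k * (Suc k + 1) div 2) * ln r ^ Suc k"
      using F'(1) by blast
  qed (use IH(1) K(1) c'0 c'1 in auto)
qed

section \<open>From moving flats to a kinetic net\<close>

text \<open>The rank of an index in the linear order translates coordinates indexed by
  \<open>'n\<close> into coordinates indexed by natural numbers.\<close>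

lemma bij_betw_card_less:
  "bij_betw (\<lambda>i. card {j. j < i}) (UNIV :: 'n::{finite,linorder} set) {..<CARD('n)}"
proof -
  have lt: "card {k. k < i} < card {k. k < j}" if "i < j" for i j :: 'n
    using that by (intro psubset_card_mono) auto
  have inj: "inj (\<lambda>i :: 'n. card {j. j < i})"
    by (rule injI) (metis lt less_irrefl linorder_neqE)
  have "card {j. j < i} < CARD('n)" for i :: 'n
    by (intro psubset_card_mono) auto
  then have "range (\<lambda>i :: 'n. card {j. j < i}) \<subseteq> {..<CARD('n)}" by auto
  moreover have "card (range (\<lambda>i :: 'n. card {j. j < i})) = card {..<CARD('n)}"
    by (simp add: card_image[OF inj])
  ultimately have "range (\<lambda>i :: 'n. card {j. j < i}) = {..<CARD('n)}"
    by (intro card_subset_eq) auto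
  with inj show ?thesis by (simp add: bij_betw_def)
qed

lemma rational_fun_1: "rational_fun a 1 = polynomial_fun a"
  by (simp add: rational_fun_def polynomial_fun_def fun_eq_iff)

lemma description_complexity_mono:
  "description_complexity \<beta> P \<Longrightarrow> \<beta> \<le> \<gamma> \<Longrightarrow> description_complexity \<gamma> P"
  unfolding description_complexity_def by (meson order_trans)

lemma kinetic_weak_net_self:
  fixes P :: "'n::finite moving_point set" and r :: real
  assumes "r > 0"
  shows "kinetic_weak_net r P P"
proof -
  have "S \<noteq> {}" if "real (card S) > card P / r" for S :: "(real, 'n) vec set"
  proof -
    have "card P / r \<ge> 0" using assms by simp
    with that show ?thesis by auto
  qed
  then show ?thesis by (simp add: kinetic_weak_net_def)
qed

lemma card_hyperplane_points_le:
  fixes v :: "real ^ 'n::finite"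
  assumes gp: "general_position P" and t: "t \<ge> 0" and v: "v \<noteq> 0"
    and S: "finite S" "S \<subseteq> positions P t" "\<And>y. y \<in> S \<Longrightarrow> v \<bullet> y = c"
  shows "card S \<le> CARD('n) + 1"
proof (rule ccontr)
  assume "\<not> ?thesis"
  then obtain A where A: "A \<subseteq> S" "card A = CARD('n) + 2"
    using obtain_subset_with_card_n[of "CARD('n) + 2" S] by auto
  have "hyperplane {y. v \<bullet> y = c}" using v unfolding hyperplane_def by blast
  moreover have "A \<subseteq> {y. v \<bullet> y = c}" using A(1) S(3) by auto
  moreover have "A \<subseteq> positions P t" using A(1) S(2) by blast
  ultimately show False using gp t A(2) unfolding general_position_def by blast
qed

text \<open>When all coordinates are fixed the flat is a point, and meeting a simplex with vertices
  in \<open>Q\<close> means lying in its hull, hence in the convex set.\<close>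

lemma kinetic_flats_imp_weak_net:
  fixes P :: "('n::{finite,linorder}) moving_point set" and f :: "'n moving_point \<Rightarrow> 'n \<Rightarrow> real poly"
  defines "idx \<equiv> \<lambda>i :: 'n. card {j. j < i}"
  assumes P: "finite P" and f: "\<And>p i. p \<in> P \<Longrightarrow> p i = polynomial_fun (f p i)"
    and gp: "general_position P" and x: "\<And>p i. x p (idx i) = f p i"
    and F: "kinetic_flats CARD('n) CARD('n) \<gamma> c m r P x F" and c: "c > 0" and r: "r > 0"
    and large: "card P / r \<ge> m"
  shows "kinetic_weak_net r P ((\<lambda>(a, b) i. rational_fun (a (idx i)) (b (idx i))) ` F)"
  unfolding kinetic_weak_net_def
proof (intro allI impI, elim conjE)
  fix t :: real and Cs :: "(real, 'n) vec set"
  assume t: "t \<ge> 0" and conv: "convex Cs" and big: "real (card (Cs \<inter> positions P t)) > card P / r"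
  let ?d = "CARD('n)"
  have bij: "bij_betw idx UNIV {..<?d}" unfolding idx_def by (rule bij_betw_card_less)
  have idx: "idx i < ?d" for i using bij_betw_apply[OF bij, of i] by simp
  define pos where "pos = (\<lambda>p. \<chi> i. poly (f p i) t)"
  have "position p t = Some (pos p)" if "p \<in> P" for p
    using t f[OF that] by (simp add: position_def polynomial_fun_def pos_def)
  then have posP: "positions P t = pos ` P" by (force simp: positions_def)
  \<comment> \<open>One moving point is chosen for each position in the convex set, so that
    \<open>Q\<close> has as many elements as there are positions.\<close>
  obtain Q where Q: "Q \<subseteq> P" "inj_on pos Q" "Cs \<inter> pos ` P = pos ` Q"
    using subset_image_inj[of "Cs \<inter> pos ` P" pos P] by auto
  have fQ: "finite Q" using Q(1) P by (rule finite_subset)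
  have cQ: "card P / r < card Q" using big Q(2,3) by (simp add: posP card_image)
  have "card P / r \<ge> 0" using r by simp
  with cQ have Qpos: "real (card Q) > 0" by linarith
  have "generic_at ?d x Q t" unfolding generic_at_def
  proof (intro allI impI)
    fix h :: "nat \<Rightarrow> real" and e assume "\<exists>j<?d. h j \<noteq> 0"
    then obtain j where j: "j < ?d" "h j \<noteq> 0" by blast
    define v :: "(real, 'n) vec" where "v = (\<chi> i. h (idx i))"
    define S where "S = {q\<in>Q. (\<Sum>j<?d. h j * poly (x q j) t) = e}"
    obtain i where "j = idx i" using bij j(1) by (metis bij_betw_imp_surj_on imageE lessThan_iff)
    then have "v \<noteq> 0" using j(2) by (metis v_def vec_lambda_beta zero_index)
    moreover have "v \<bullet> pos q = (\<Sum>j<?d. h j * poly (x q j) t)" for q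
    proof -
      have "v \<bullet> pos q = (\<Sum>i\<in>UNIV. h (idx i) * poly (x q (idx i)) t)"
        by (simp add: inner_vec_def v_def pos_def x)
      also have "\<dots> = (\<Sum>j<?d. h j * poly (x q j) t)" by (rule sum.reindex_bij_betw[OF bij])
      finally show ?thesis .
    qed
    ultimately have "card (pos ` S) \<le> ?d + 1"
      using gp t fQ Q(1) by (intro card_hyperplane_points_le[where v = v and c = e]) (auto simp: S_def posP)
    moreover have "inj_on pos S" using Q(2) by (rule inj_on_subset) (auto simp: S_def)
    ultimately show "card S \<le> ?d + 1" by (simp add: card_image)
  qed
  moreover have "m \<le> card Q" using large cQ by linarith
  ultimately obtain a b where ab: "(a, b) \<in> F" "\<forall>i<?d. poly (b i) t \<noteq> 0"
    "c * real (card Q) ^ Suc ?d \<le> card {\<sigma> \<in> {..?d} \<rightarrow>\<^sub>E Q.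
       simplex_meets_flat ?d (\<lambda>i j. poly (x (\<sigma> i) j) t) (\<lambda>i. poly (a i) t / poly (b i) t)}"
    using F Q(1) cQ unfolding kinetic_flats_def by blast
  \<comment> \<open>A positive lower bound on the count yields at least one such simplex.\<close>
  have "c * real (card Q) ^ Suc ?d > 0" using c Qpos by simp
  with ab(3) have "{\<sigma> \<in> {..?d} \<rightarrow>\<^sub>E Q.
       simplex_meets_flat ?d (\<lambda>i j. poly (x (\<sigma> i) j) t) (\<lambda>i. poly (a i) t / poly (b i) t)} \<noteq> {}"
    by (metis card.empty less_le_not_le of_nat_0)
  then obtain \<sigma> \<mu> where s: "\<sigma> \<in> {..?d} \<rightarrow>\<^sub>E Q" "\<forall>i\<le>?d. 0 \<le> \<mu> i" "(\<Sum>i\<le>?d. \<mu> i) = 1"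
    "\<forall>j<?d. (\<Sum>i\<le>?d. \<mu> i * poly (x (\<sigma> i) j) t) = poly (a j) t / poly (b j) t"
    unfolding simplex_meets_flat_def by blast
  define y :: "(real, 'n) vec" where "y = (\<chi> i. poly (a (idx i)) t / poly (b (idx i)) t)"
  have "(\<Sum>k\<le>?d. \<mu> k *\<^sub>R pos (\<sigma> k)) = y"
    using s(4) idx by (simp add: vec_eq_iff y_def pos_def flip: x)
  moreover have "pos q \<in> Cs" if "q \<in> Q" for q using Q(3) that by blast
  then have "(\<Sum>k\<le>?d. \<mu> k *\<^sub>R pos (\<sigma> k)) \<in> Cs"
    using conv s by (intro convex_sum) auto
  moreover have "position (\<lambda>i. rational_fun (a (idx i)) (b (idx i))) t = Some y"
    using t ab(2) idx by (simp add: position_def rational_fun_def y_def)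
  ultimately show "Cs \<inter> positions ((\<lambda>(a, b) i. rational_fun (a (idx i)) (b (idx i))) ` F) t \<noteq> {}"
    using ab(1) by (force simp: positions_def)
qed

text \<open>The linear order on \<open>'n\<close> gives meaning to the first coordinate,
  \<open>Min UNIV\<close>.\<close>

theorem mainTheorem6:
  fixes \<beta> :: nat
  assumes "\<beta> \<ge> 1"
  shows "\<exists>(C::real) (g::nat).
    \<forall>(P :: ('n::{finite,linorder}) moving_point set) (r::real).
      finite P \<and> (\<forall>p\<in>P. moves_polynomially p) \<and> description_complexity \<beta> P \<and>
      general_position P \<and> r \<ge> 2 \<longrightarrow>
      (\<exists>N :: 'n moving_point set.
         finite N \<and> kinetic_weak_net r P N \<and>
         real (card N) \<le> C * r ^ (CARD('n) * (CARD('n) + 1) div 2) * (ln r) ^ CARD('n) \<and>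
         description_complexity g N \<and>
         (\<forall>p\<in>N. is_polynomial (p (Min UNIV))))"
proof -
  let ?d = "CARD('n)"
  let ?e = "?d * (?d + 1) div 2"
  obtain C \<gamma> c m where K: "0 \<le> C" "0 < c" "c \<le> 1" "\<forall>(P :: 'n moving_point set) x r. finite P \<and>
      (\<forall>p\<in>P. \<forall>j. degree (x p j) \<le> \<beta>) \<and> r \<ge> 2 \<longrightarrow>
    (\<exists>F. kinetic_flats ?d ?d \<gamma> c m r P x F \<and> real (card F) \<le> C * r ^ ?e * ln r ^ ?d)"
    using kinetic_flats_exist[of ?d ?d \<beta>, where 'p = "'n moving_point", OF order_refl]
    by (elim exE conjE) (rule that)
  \<comment> \<open>The second summand serves bounded \<open>n / r\<close>, where
    \<open>n \<le> m * r\<close> is compared with the bound by means of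
    \<open>ln r \<ge> ln 2\<close>.\<close>
  define C' where "C' = C + m / ln 2 ^ ?d"
  have d1: "?d \<ge> 1" by (simp add: Suc_le_eq)
  have "2 * 1 \<le> ?d * (?d + 1)" using mult_le_mono[OF d1, of 2 "?d + 1"] d1 by simp
  then have e1: "?e \<ge> 1" by linarith
  show ?thesis
  proof (rule exI[of _ C'], rule exI[of _ "\<gamma> + \<beta>"], intro allI impI, elim conjE)
    fix P :: "'n moving_point set" and r :: real
    assume P: "finite P" and mp: "\<forall>p\<in>P. moves_polynomially p" and dc: "description_complexity \<beta> P"
      and gp: "general_position P" and r: "2 \<le> r"
    have lnr: "ln 2 \<le> ln r" "0 < ln r" using r by simp_all
    have pw: "ln 2 ^ ?d \<le> ln r ^ ?d" using lnr(1) by (intro power_mono) auto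
    show "\<exists>N :: 'n moving_point set. finite N \<and> kinetic_weak_net r P N \<and>
         real (card N) \<le> C' * r ^ ?e * ln r ^ ?d \<and>
         description_complexity (\<gamma> + \<beta>) N \<and> (\<forall>p\<in>N. is_polynomial (p (Min UNIV)))"
    proof (cases "card P / r < m")
      \<comment> \<open>Few points relative to \<open>r\<close>: \<open>P\<close> itself is the
        net.\<close>
      case True
      have "real (card P) \<le> m * r" using True r by (simp add: field_simps)
      also have "\<dots> \<le> m * r ^ ?e" using e1 r by (intro mult_left_mono self_le_power) auto
      also have "\<dots> = (m / ln 2 ^ ?d) * r ^ ?e * ln 2 ^ ?d" by simp
      also have "\<dots> \<le> (m / ln 2 ^ ?d) * r ^ ?e * ln r ^ ?d" using pw r by (intro mult_left_mono) auto
      also have "\<dots> \<le> C' * r ^ ?e * ln r ^ ?d"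
        unfolding C'_def using K(1) r lnr by (intro mult_right_mono) auto
      finally have "real (card P) \<le> C' * r ^ ?e * ln r ^ ?d" .
      moreover have "kinetic_weak_net r P P" using r by (intro kinetic_weak_net_self) simp
      moreover have "description_complexity (\<gamma> + \<beta>) P"
        using dc by (rule description_complexity_mono) simp
      ultimately show ?thesis using P mp by (auto simp: moves_polynomially_def)
    next
      case False
      define idx where "idx = (\<lambda>i :: 'n. card {j. j < i})"
      have bij: "bij_betw idx UNIV {..<?d}" unfolding idx_def by (rule bij_betw_card_less)
      have idx: "idx i < ?d" for i using bij_betw_apply[OF bij, of i] by simp
      \<comment> \<open>The first coordinate has rank 0, where all denominators of the flats are
        1.\<close>
      have "{j :: 'n. j < Min UNIV} = {}" by (auto simp: not_less)
      then have idx0: "idx (Min UNIV) = 0" by (simp add: idx_def)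
      have "\<forall>p. \<exists>f. p \<in> P \<longrightarrow> (\<forall>i. degree (f i) \<le> \<beta> \<and> p i = polynomial_fun (f i))"
        using dc description_complexity_polynomial_iff[OF mp, of \<beta>] by metis
      then obtain f where f: "\<And>p i. p \<in> P \<Longrightarrow> degree (f p i) \<le> \<beta> \<and> p i = polynomial_fun (f p i)"
        by metis
      define x where "x = (\<lambda>p j. f p (inv idx j))"
      have x: "x p (idx i) = f p i" for p i
        using bij by (simp add: x_def bij_betw_def)
      obtain F where F: "kinetic_flats ?d ?d \<gamma> c m r P x F" "real (card F) \<le> C * r ^ ?e * ln r ^ ?d"
        using K(4)[rule_format, of P x r] P f r by (auto simp: x_def)
      define N where "N = (\<lambda>(a, b) i. rational_fun (a (idx i)) (b (idx i))) ` F"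
      have fF: "finite F" and Fab: "\<And>a b. (a, b) \<in> F \<Longrightarrow>
          (\<forall>i<?d. b i \<noteq> 0 \<and> degree (a i) \<le> \<gamma> \<and> degree (b i) \<le> \<gamma>) \<and> b 0 = 1"
        using F(1) unfolding kinetic_flats_def by auto
      have "kinetic_weak_net r P N" unfolding N_def idx_def
        using P f gp x F(1) K(2) r False by (intro kinetic_flats_imp_weak_net) (auto simp: idx_def)
      moreover have "real (card N) \<le> C' * r ^ ?e * ln r ^ ?d"
      proof -
        have "real (card N) \<le> card F" unfolding N_def using card_image_le[OF fF] by simp
        also note F(2)
        also have "C * r ^ ?e * ln r ^ ?d \<le> C' * r ^ ?e * ln r ^ ?d"
          unfolding C'_def using r lnr by (intro mult_right_mono) auto
        finally show ?thesis .
      qed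
      moreover have "description_complexity (\<gamma> + \<beta>) N"
        unfolding description_complexity_def
      proof (intro ballI allI)
        fix p i assume "p \<in> N"
        then obtain a b where ab: "(a, b) \<in> F" "p = (\<lambda>i. rational_fun (a (idx i)) (b (idx i)))"
          by (auto simp: N_def)
        show "\<exists>a b. b \<noteq> 0 \<and> degree a \<le> \<gamma> + \<beta> \<and> degree b \<le> \<gamma> + \<beta> \<and> p i = rational_fun a b"
          using Fab[OF ab(1)] idx[of i] ab(2)
          by (intro exI[of _ "a (idx i)"] exI[of _ "b (idx i)"]) (auto simp: trans_le_add1)
      qed
      moreover have "\<forall>p\<in>N. is_polynomial (p (Min UNIV))"
        using Fab rational_fun_1 by (fastforce simp: N_def idx0 is_polynomial_def)
      moreover have "finite N" using fF by (simp add: N_def)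
      ultimately show ?thesis by blast
    qed
  qed
qed



end
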